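(* Let $(\mathcal{C},\mathcal{D})$ be a regular $C^*$-inclusion and let $\mathcal{M}\subseteq\mathcal{C}$ be a norm-closed $\mathcal{D}$-bimodule. With the relative weak-$*$ topology, $\mathcal{E}^1(\mathcal{M})\cup\{0\}$ is compact. Thus, $\mathcal{E}^1(\mathcal{M})$ is a locally compact Hausdorff space.
   Context: Let $\mathcal{C}$ be a unital $C^*$-algebra and $\mathcal{D}\subseteq\mathcal{C}$ an abelian $C^*$-subalgebra containing the unit. $\mathcal{N}(\mathcal{C})=\{v\in\mathcal{C}:v\mathcal{D}v^*\cup v^*\mathcal{D}v\subseteq\mathcal{D}\}$ is the set of normalizers. $\mathcal{D}$ has the extension property in $\mathcal{C}$ if every pure state of $\mathcal{D}$ has a unique extension to a state of $\mathcal{C}$ and no pure state of $\mathcal{C}$ annihilates $\mathcal{D}$. $(\mathcal{C},\mathcal{D})$ is a regular $C^*$-inclusion if $\mathcal{D}$ is a maximal abelian $C^*$-subalgebra of the unital $C^*$-algebra $\mathcal{C}$, $\mathcal{D}$ has the extension property in $\mathcal{C}$, and the closed linear span of $\mathcal{N}(\mathcal{C})$ is $\mathcal{C}$. A $\mathcal{D}$-bimodule $\mathcal{M}\subseteq\mathcal{C}$ is a subspace with $d\,m\,e\in\mathcal{M}$ for $d,e\in\mathcal{D}$, $m\in\mathcal{M}$. $\mathcal{E}^1(\mathcal{M})$ is the set of norm-one bounded linear functionals $\phi$ on $\mathcal{M}$ such that for every $d\in\mathcal{D}$ the functionals $m\mapsto\phi(dm)$ and $m\mapsto\phi(md)$ are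 scalar multiples of $\phi$, with the relative weak-$*$ topology from the Banach space dual of $\mathcal{M}$. *)

theory Defs
  imports "HOL-Analysis.Analysis"
begin

class cstar_algebra_1 = real_normed_algebra_1 + banach +
  fixes scaleC :: "complex \<Rightarrow> 'a \<Rightarrow> 'a"  (infixr "*\<^sub>C" 75)
    and star :: "'a \<Rightarrow> 'a"
  assumes scaleC_add_right: "c *\<^sub>C (x + y) = c *\<^sub>C x + c *\<^sub>C y"
    and scaleC_add_left: "(b + c) *\<^sub>C x = b *\<^sub>C x + c *\<^sub>C x"
    and scaleC_scaleC: "b *\<^sub>C c *\<^sub>C x = (b * c) *\<^sub>C x"
    and scaleC_of_real: "complex_of_real r *\<^sub>C x = r *\<^sub>R x"
    and mult_scaleC_left: "(c *\<^sub>C x) * y = c *\<^sub>C (x * y)"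
    and mult_scaleC_right: "x * (c *\<^sub>C y) = c *\<^sub>C (x * y)"
    and norm_scaleC: "norm (c *\<^sub>C x) = norm c * norm x"
    and star_star: "star (star x) = x"
    and star_add: "star (x + y) = star x + star y"
    and star_scaleC: "star (c *\<^sub>C x) = cnj c *\<^sub>C star x"
    and star_mult: "star (x * y) = star y * star x"
    and cstar_identity: "norm (star x * x) = (norm x)\<^sup>2"

global_interpretation complex_vector: vector_space "scaleC :: complex \<Rightarrow> 'a \<Rightarrow> 'a::cstar_algebra_1"
  defines csubspace = "complex_vector.subspace"
    and cspan = "complex_vector.span"
proof
  show "1 *\<^sub>C x = x" for x :: 'a
    using scaleC_of_real [of 1 x] by simp
qed (simp_all add: scaleC_add_right scaleC_add_left scaleC_scaleC)

definition cstar_subalgebra :: "'a::cstar_algebra_1 set \<Rightarrow> bool" where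
  "cstar_subalgebra A \<longleftrightarrow>
     csubspace A \<and> (\<forall>x\<in>A. \<forall>y\<in>A. x * y \<in> A) \<and> (\<forall>x\<in>A. star x \<in> A) \<and> closed A"

definition abelian_cstar_subalgebra :: "'a::cstar_algebra_1 set \<Rightarrow> bool" where
  "abelian_cstar_subalgebra A \<longleftrightarrow> cstar_subalgebra A \<and> (\<forall>x\<in>A. \<forall>y\<in>A. x * y = y * x)"

definition maximal_abelian_cstar_subalgebra :: "'a::cstar_algebra_1 set \<Rightarrow> bool" where
  "maximal_abelian_cstar_subalgebra D \<longleftrightarrow>
     abelian_cstar_subalgebra D \<and> (\<forall>A. abelian_cstar_subalgebra A \<and> D \<subseteq> A \<longrightarrow> A = D)"

definition normalizers :: "'a::cstar_algebra_1 set \<Rightarrow> 'a set" where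
  "normalizers D = {v. \<forall>d\<in>D. v * d * star v \<in> D \<and> star v * d * v \<in> D}"

text \<open>Functionals on a subspace \<open>M\<close> are functions that are \<^term>\<open>undefined\<close> off \<open>M\<close>, so that
  equality of functionals on \<open>M\<close> is equality in HOL.\<close>

definition cdual :: "'a::cstar_algebra_1 set \<Rightarrow> ('a \<Rightarrow> complex) set" where
  "cdual M = {\<phi> \<in> extensional M.
     (\<forall>x\<in>M. \<forall>y\<in>M. \<phi> (x + y) = \<phi> x + \<phi> y) \<and>
     (\<forall>c. \<forall>x\<in>M. \<phi> (c *\<^sub>C x) = c * \<phi> x) \<and>
     (\<exists>K. \<forall>x\<in>M. norm (\<phi> x) \<le> K * norm x)}"

definition dual_norm :: "'a::cstar_algebra_1 set \<Rightarrow> ('a \<Rightarrow> complex) \<Rightarrow> real" where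
  "dual_norm M \<phi> = (SUP x\<in>{x\<in>M. norm x \<le> 1}. norm (\<phi> x))"

text \<open>The topology of pointwise convergence on \<open>M\<close>.\<close>

definition weak_star :: "'a::cstar_algebra_1 set \<Rightarrow> ('a \<Rightarrow> complex) topology" where
  "weak_star M = subtopology (product_topology (\<lambda>_. euclidean) M) (cdual M)"

text \<open>The positive elements of a C*-algebra \<open>A\<close> are those of the form \<open>star a * a\<close>
  with \<open>a \<in> A\<close>.\<close>

definition states :: "'a::cstar_algebra_1 set \<Rightarrow> ('a \<Rightarrow> complex) set" where
  "states A = {\<rho> \<in> cdual A. (\<forall>a\<in>A. \<rho> (star a * a) \<in> \<real>\<^sub>\<ge>\<^sub>0) \<and> dual_norm A \<rho> = 1}"

text \<open>Extreme points of the state space; the library's \<^const>\<open>extreme_point_of\<close> does not apply,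
  since the function type is not a real vector space in the sense of the type class.\<close>

definition pure_states :: "'a::cstar_algebra_1 set \<Rightarrow> ('a \<Rightarrow> complex) set" where
  "pure_states A = {\<rho> \<in> states A. \<forall>\<sigma>\<in>states A. \<forall>\<tau>\<in>states A. \<forall>t::real. 0 < t \<and> t < 1 \<and>
     (\<forall>a\<in>A. \<rho> a = of_real t * \<sigma> a + of_real (1 - t) * \<tau> a) \<longrightarrow> \<sigma> = \<rho> \<and> \<tau> = \<rho>}"

definition extension_property :: "'a::cstar_algebra_1 set \<Rightarrow> bool" where
  "extension_property D \<longleftrightarrow>
     (\<forall>\<rho>\<in>pure_states D. \<exists>!\<sigma>. \<sigma> \<in> states UNIV \<and> (\<forall>d\<in>D. \<sigma> d = \<rho> d)) \<and>
     (\<forall>\<sigma>\<in>pure_states (UNIV :: 'a set). \<exists>d\<in>D. \<sigma> d \<noteq> 0)"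

definition regular_cstar_inclusion :: "'a::cstar_algebra_1 set \<Rightarrow> bool" where
  "regular_cstar_inclusion D \<longleftrightarrow>
     1 \<in> D \<and> maximal_abelian_cstar_subalgebra D \<and> extension_property D \<and>
     closure (cspan (normalizers D)) = UNIV"

definition bimodule :: "'a::cstar_algebra_1 set \<Rightarrow> 'a set \<Rightarrow> bool" where
  "bimodule D M \<longleftrightarrow> csubspace M \<and> (\<forall>d\<in>D. \<forall>e\<in>D. \<forall>m\<in>M. d * m * e \<in> M)"

definition norm_one_eigenfunctionals ::
    "'a::cstar_algebra_1 set \<Rightarrow> 'a set \<Rightarrow> ('a \<Rightarrow> complex) set"  ("\<E>\<^sup>1") where
  "\<E>\<^sup>1 D M = {\<phi> \<in> cdual M. dual_norm M \<phi> = 1 \<and>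
     (\<forall>d\<in>D. (\<exists>c. \<forall>m\<in>M. \<phi> (d * m) = c * \<phi> m) \<and> (\<exists>c. \<forall>m\<in>M. \<phi> (m * d) = c * \<phi> m))}"

end

theory Submission imports Defs begin

text \<open>
  An eigenfunctional \<open>\<phi> \<noteq> 0\<close> on \<open>M\<close> satisfies \<open>\<phi> (d * m) = \<sigma> d * \<phi> m\<close> and \<open>\<phi> (m * d) = \<rho> d * \<phi> m\<close>
  for two characters \<open>\<sigma>\<close>, \<open>\<rho>\<close> of \<open>D\<close>, its range and its source. Boundedness by 1, linearity and
  the eigenvalue equations pass to pointwise limits, so by Tychonoff's theorem the only danger is
  that a nonzero limit \<open>\<phi>\<close> of norm-one eigenfunctionals \<open>\<psi>\<close> has norm less than 1.

  The norm is controlled by normalizers. Let \<open>e\<close> and \<open>f\<close> range over the self-adjoint contractions of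
  \<open>D\<close> on which \<open>\<sigma>\<close>, respectively \<open>\<rho>\<close>, takes the value 1. Then \<open>\<phi> m = \<phi> (e * m * f)\<close>, so \<open>m\<close> stays large
  under all these compressions. As \<open>m\<close> is close to a finite sum of normalizers, one of these, \<open>v\<close>,
  stays large too, and this forces \<open>\<sigma> (v * d * star v) = \<rho> d * \<rho> (star v * v)\<close>
  (lemma \<open>normalizer_linked\<close>). The extension property enters through excision: if \<open>ext \<rho>\<close> is the
  unique state extending \<open>\<rho>\<close>, then \<open>f * x * f\<close> is close to \<open>ext \<rho> x\<close> times \<open>f * f\<close> for suitable
  \<open>f\<close> (lemma \<open>excision\<close>). Applied to \<open>x = star v * m\<close>, for a \<open>v\<close> as above, this gives
  \<open>norm (\<phi> m) * sqrt (Re (\<rho> (star v * v))) = dual_norm M \<phi> * norm (ext \<rho> (star v * m))\<close>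
  whenever \<open>\<phi> m \<noteq> 0\<close> (lemma \<open>eigenfunctional_norm_eq\<close>). All terms other than
  \<open>dual_norm M \<phi>\<close> are continuous along the limit; for \<open>ext \<rho>\<close> the reason is that its real part is an
  infimum of values of \<open>\<rho>\<close> on \<open>D\<close>. One normalizer \<open>v\<close> serves for frequently many \<open>\<psi>\<close>, since only finitely
  many compete, and therefore \<open>dual_norm M \<phi> = 1\<close>.

  Excision compares elements in the order of the algebra and then returns to norms. The part of
  the order theory that this needs is derived without spectra: positivity of \<open>h\<close> means
  \<open>norm (t *\<^sub>R 1 - h) \<le> t\<close> for some \<open>t\<close>, the binomial series supplies square roots, and from these
  come positivity of \<open>star a * a\<close> and the norm bound for an element lying between \<open>-t\<close> and \<open>t\<close>.
\<close>

section \<open>The involution\<close>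

lemma scaleR_scaleC: "r *\<^sub>R x = complex_of_real r *\<^sub>C x" for x :: "'a::cstar_algebra_1"
  by (simp add: scaleC_of_real)

lemma star_zero [simp]: "star (0::'a::cstar_algebra_1) = 0"
  using star_add[of "0::'a" 0] by simp

lemma star_minus [simp]: "star (- x) = - star (x::'a::cstar_algebra_1)"
  using star_add[of x "- x"] by (simp add: eq_neg_iff_add_eq_0 add.commute)

lemma star_diff [simp]: "star (x - y) = star x - star (y::'a::cstar_algebra_1)"
  using star_add[of x "- y"] by simp

lemma star_scaleR [simp]: "star (r *\<^sub>R x) = r *\<^sub>R star (x::'a::cstar_algebra_1)"
  by (simp add: scaleR_scaleC star_scaleC)

lemma star_one [simp]: "star (1::'a::cstar_algebra_1) = 1"
  by (metis mult_1_left mult_1_right star_mult star_star)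

lemma star_power [simp]: "star (x ^ n) = star (x::'a::cstar_algebra_1) ^ n"
  by (induction n) (simp_all add: star_mult power_commutes)

lemmas star_simps [simp] = star_star star_add star_mult

lemma norm_star [simp]: "norm (star x) = norm (x::'a::cstar_algebra_1)"
proof -
  have "norm x \<le> norm (star x)" for x :: 'a
  proof (cases "x = 0")
    case False
    have "norm x * norm x \<le> norm (star x) * norm x"
      using cstar_identity[of x] norm_mult_ineq[of "star x" x] by (simp add: power2_eq_square)
    then show ?thesis using False by simp
  qed simp
  from this[of x] this[of "star x"] show ?thesis by simp
qed

lemma bounded_linear_star: "bounded_linear (star :: 'a::cstar_algebra_1 \<Rightarrow> 'a)"
  by (rule bounded_linear_intro[where K=1]) simp_all

lemma norm_square_selfadjoint: "star h = h \<Longrightarrow> norm (h * h) = (norm h)\<^sup>2"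
  for h :: "'a::cstar_algebra_1"
  using cstar_identity[of h] by simp

lemma scaleC_scaleR_commute: "c *\<^sub>C (r *\<^sub>R x) = r *\<^sub>R (c *\<^sub>C (x::'a::cstar_algebra_1))"
  by (simp add: scaleR_scaleC scaleC_scaleC mult.commute)

lemma scaleC_minus_right [simp]: "c *\<^sub>C (- x) = - (c *\<^sub>C (x::'a::cstar_algebra_1))"
  by (rule complex_vector.scale_minus_right)

lemma scaleC_diff_right: "c *\<^sub>C (x - y) = c *\<^sub>C x - c *\<^sub>C (y::'a::cstar_algebra_1)"
  by (rule complex_vector.scale_right_diff_distrib)

section \<open>Square roots\<close>

text \<open>
  A square root will be a norm limit of real polynomials, so it lies in every set of this kind that
  contains the given element. Used for \<open>D\<close> itself and for commutants.
\<close>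

definition closed_subalgebra :: "'a::cstar_algebra_1 set \<Rightarrow> bool" where
  "closed_subalgebra A \<longleftrightarrow> subspace A \<and> 1 \<in> A \<and> (\<forall>x\<in>A. \<forall>y\<in>A. x * y \<in> A) \<and> closed A"

lemma closed_subalgebra_power: "closed_subalgebra A \<Longrightarrow> x \<in> A \<Longrightarrow> x ^ n \<in> A"
  by (induction n) (auto simp: closed_subalgebra_def)

lemma closed_subalgebra_commutant: "closed_subalgebra {x. x * y = y * x}"
  for y :: "'a::cstar_algebra_1"
  unfolding closed_subalgebra_def
proof (intro conjI ballI)
  show "subspace {x. x * y = y * x}"
    by (auto simp: subspace_def algebra_simps)
  show "a * b \<in> {x. x * y = y * x}" if "a \<in> {x. x * y = y * x}" "b \<in> {x. x * y = y * x}" for a b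
    using that by simp (metis mult.assoc)
  show "closed {x. x * y = y * x}"
    by (intro closed_Collect_eq continuous_intros)
qed simp

text \<open>
  The coefficients of the expansion of \<open>sqrt (1 - z)\<close> in powers of \<open>z\<close>. All but the first are
  nonpositive and their sum stays nonnegative, so the series converges absolutely even for
  \<open>norm z = 1\<close>. This boundary case makes every positive element have a square root.
\<close>

definition sqrt_coeff :: "nat \<Rightarrow> real" where
  "sqrt_coeff n = ((1/2) gchoose n) * (- 1) ^ n"

lemma sqrt_coeff_0 [simp]: "sqrt_coeff 0 = 1"
  by (simp add: sqrt_coeff_def)

lemma sqrt_coeff_nonpos: "sqrt_coeff (Suc n) \<le> 0"
proof -
  have "sqrt_coeff (Suc n) = pochhammer (- (1/2)) (Suc n) / fact (Suc n)"
    by (simp add: sqrt_coeff_def gbinomial_pochhammer power_mult_distrib[symmetric] field_simps)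
  moreover have "pochhammer (- (1/2)) (Suc n) = - (1/2) * pochhammer (1/2::real) n"
    by (simp add: pochhammer_rec)
  moreover have "pochhammer (1/2::real) n > 0" by (rule pochhammer_pos) simp
  ultimately have "sqrt_coeff (Suc n) = - ((1/2) * pochhammer (1/2) n / fact (Suc n))" by simp
  then show ?thesis using \<open>pochhammer (1/2::real) n > 0\<close> by (simp del: fact_Suc)
qed

lemma sqrt_coeff_partial: "(\<Sum>n<m. \<bar>sqrt_coeff (Suc n)\<bar>) \<le> 1"
proof -
  have "(\<Sum>n\<le>m. sqrt_coeff n) = pochhammer (1/2) m / fact m"
    unfolding sqrt_coeff_def gbinomial_sum_lower_neg
    by (simp add: gbinomial_pochhammer power_mult_distrib[symmetric])
  then have "(\<Sum>n\<le>m. sqrt_coeff n) \<ge> 0"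
    using pochhammer_pos[of "1/2::real" m] by simp
  moreover have "(\<Sum>n\<le>m. sqrt_coeff n) = 1 + (\<Sum>n<m. sqrt_coeff (Suc n))"
    by (simp add: sum.atMost_shift)
  moreover have "(\<Sum>n<m. \<bar>sqrt_coeff (Suc n)\<bar>) = - (\<Sum>n<m. sqrt_coeff (Suc n))"
    using sqrt_coeff_nonpos by (simp flip: sum_negf)
  ultimately show ?thesis by simp
qed

lemma sqrt_coeff_summable: "summable (\<lambda>n. \<bar>sqrt_coeff (Suc n)\<bar>)"
  and sqrt_coeff_suminf: "(\<Sum>n. \<bar>sqrt_coeff (Suc n)\<bar>) \<le> 1"
proof -
  show *: "summable (\<lambda>n. \<bar>sqrt_coeff (Suc n)\<bar>)"
    by (rule summableI_nonneg_bounded[where x=1]) (auto simp: sqrt_coeff_partial)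
  show "(\<Sum>n. \<bar>sqrt_coeff (Suc n)\<bar>) \<le> 1"
    by (rule suminf_le_const[OF *]) (rule sqrt_coeff_partial)
qed

lemma sqrt_coeff_convolution:
  "(\<Sum>i\<le>n. sqrt_coeff i * sqrt_coeff (n - i)) = (if n = 0 then 1 else if n = 1 then -1 else 0)"
proof -
  have "(\<Sum>i\<le>n. sqrt_coeff i * sqrt_coeff (n - i))
      = (\<Sum>i\<le>n. (-1)^n * (((1/2) gchoose i) * ((1/2) gchoose (n - i))))"
    by (rule sum.cong) (auto simp: sqrt_coeff_def mult_ac simp flip: power_add)
  also have "\<dots> = (-1)^n * (\<Sum>i=0..n. ((1/2) gchoose i) * ((1/2) gchoose (n - i)))"
    by (simp add: sum_distrib_left atMost_atLeast0)
  also have "\<dots> = (-1)^n * (1 gchoose n)"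
    by (subst gbinomial_Vandermonde) simp
  also have "(1::real) gchoose n = of_nat (1 choose n)"
    by (metis binomial_gbinomial of_nat_1)
  finally show ?thesis
    by (cases n; cases "n - 1") auto
qed

lemma ex_sqrt_one_minus:
  fixes z :: "'a::cstar_algebra_1"
  assumes z: "norm z \<le> 1" "star z = z"
  obtains b where "star b = b" "b * b = 1 - z" "norm (1 - b) \<le> 1"
    "\<And>A. closed_subalgebra A \<Longrightarrow> z \<in> A \<Longrightarrow> b \<in> A"
proof -
  define f where "f = (\<lambda>n. sqrt_coeff n *\<^sub>R z ^ n)"
  have zn: "norm (z ^ n) \<le> 1" for n
    using z(1) by (meson norm_ge_zero norm_power_ineq order_trans power_le_one)
  have fle: "norm (f n) \<le> \<bar>sqrt_coeff n\<bar>" for n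
    using mult_left_mono[OF zn, of "\<bar>sqrt_coeff n\<bar>" n] by (simp add: f_def)
  have nsum: "summable (\<lambda>n. norm (f (Suc n)))"
    by (rule summable_comparison_test[OF _ sqrt_coeff_summable]) (use fle in auto)
  then have ns: "summable (\<lambda>n. norm (f n))" by (subst (asm) summable_Suc_iff)
  define b where "b = (\<Sum>n. f n)"
  have fb: "f sums b" unfolding b_def by (rule summable_sums[OF summable_norm_cancel[OF ns]])
  have sf: "star (f n) = f n" for n by (simp add: f_def z)
  have 1: "star b = b"
    using sums_unique2[OF bounded_linear.sums[OF bounded_linear_star fb, unfolded sf] fb] .
  have "b * b = (\<Sum>k. \<Sum>i\<le>k. f i * f (k - i))"
    unfolding b_def by (rule Cauchy_product[OF ns ns])
  also have "\<dots> = (\<Sum>k. (if k = 0 then 1 else if k = 1 then -1 else 0) *\<^sub>R z ^ k)"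
  proof (rule suminf_cong)
    fix k
    have "(\<Sum>i\<le>k. f i * f (k - i)) = (\<Sum>i\<le>k. (sqrt_coeff i * sqrt_coeff (k - i)) *\<^sub>R z ^ k)"
      by (rule sum.cong) (auto simp: f_def simp flip: power_add)
    also have "\<dots> = (if k = 0 then 1 else if k = 1 then -1 else 0) *\<^sub>R z ^ k"
      by (simp only: scaleR_left.sum[symmetric] sqrt_coeff_convolution)
    finally show "(\<Sum>i\<le>k. f i * f (k - i)) = \<dots>" .
  qed
  also have "\<dots> = (\<Sum>k\<in>{0,1}. (if k = 0 then 1 else if k = 1 then -1 else 0) *\<^sub>R z ^ k)"
    by (rule suminf_finite) auto
  also have "\<dots> = 1 - z" by simp
  finally have 2: "b * b = 1 - z" .
  have "(\<lambda>n. f (Suc n)) sums (b - f 0)" using fb by (simp add: sums_Suc_iff)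
  then have "(\<Sum>n. f (Suc n)) = b - 1" by (simp add: sums_iff f_def)
  moreover have "norm (\<Sum>n. f (Suc n)) \<le> (\<Sum>n. \<bar>sqrt_coeff (Suc n)\<bar>)"
    by (rule norm_suminf_le) (use fle sqrt_coeff_summable in auto)
  ultimately have 3: "norm (1 - b) \<le> 1" using sqrt_coeff_suminf by (simp add: norm_minus_commute)
  have 4: "b \<in> A" if A: "closed_subalgebra A" "z \<in> A" for A
  proof -
    have "(\<Sum>i<n. f i) \<in> A" for n
      using A closed_subalgebra_power[OF A]
      by (auto intro!: subspace_sum simp: closed_subalgebra_def f_def subspace_scale)
    then show ?thesis using fb A unfolding sums_def closed_subalgebra_def
      by (metis closed_sequentially)
  qed
  show thesis by (rule that[OF 1 2 3 4])
qed

section \<open>Positive elements\<close>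

text \<open>
  With \<open>u = r + \<i> s\<close>, which is normal, \<open>star u * u\<close> is \<open>r * r + s * s\<close> and \<open>r * r - s * s\<close> is the
  real part of \<open>u * u\<close>; the C*-identity compares the two. This inequality takes the place of the
  functional calculus in passing from order to norm.
\<close>

lemma norm_diff_squares_le:
  fixes r s :: "'a::cstar_algebra_1"
  assumes "star r = r" "star s = s" "r * s = s * r"
  shows "norm (r * r - s * s) \<le> norm (r * r + s * s)"
proof -
  define u where "u = r + \<i> *\<^sub>C s"
  have su: "star u = r - \<i> *\<^sub>C s"
    using assms complex_vector.scale_minus_left[of \<i> s] by (simp add: u_def star_scaleC)
  have uu: "star u * u = r * r + s * s"
    using assms(3) unfolding su by (simp add: u_def algebra_simps mult_scaleC_left mult_scaleC_right
      scaleC_scaleC scaleC_diff_right scaleC_add_right complex_vector.scale_minus_left)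
  have "u * u + star u * star u = 2 *\<^sub>R (r * r - s * s)"
    using assms(3) unfolding su by (simp add: u_def algebra_simps mult_scaleC_left mult_scaleC_right
      scaleC_scaleC scaleC_diff_right scaleC_add_right complex_vector.scale_minus_left scaleR_2)
  then have "2 * norm (r * r - s * s) = norm (u * u + star u * star u)" by simp
  also have "\<dots> \<le> norm u * norm u + norm (star u) * norm (star u)"
    by (intro order_trans[OF norm_triangle_ineq] add_mono norm_mult_ineq)
  also have "\<dots> = 2 * norm (r * r + s * s)"
    by (simp add: uu[symmetric] cstar_identity power2_eq_square)
  finally show ?thesis by simp
qed

text \<open>
  Equivalently, the spectrum of the self-adjoint element \<open>h\<close> lies in the nonnegative reals. In this
  form closure under sums is the triangle inequality.
\<close>

definition pos :: "'a::cstar_algebra_1 \<Rightarrow> bool" where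
  "pos h \<longleftrightarrow> star h = h \<and> (\<exists>t\<ge>0. norm (t *\<^sub>R 1 - h) \<le> t)"

lemma pos_star: "pos h \<Longrightarrow> star h = h" by (simp add: pos_def)

lemma pos_add: "pos x \<Longrightarrow> pos y \<Longrightarrow> pos (x + y)"
proof -
  assume "pos x" "pos y"
  then obtain s t where st: "s \<ge> 0" "t \<ge> 0" "norm (s *\<^sub>R 1 - x) \<le> s" "norm (t *\<^sub>R 1 - y) \<le> t"
    "star x = x" "star y = y" unfolding pos_def by blast
  have "norm ((s + t) *\<^sub>R 1 - (x + y)) \<le> s + t"
    using st norm_triangle_ineq[of "s *\<^sub>R 1 - x" "t *\<^sub>R 1 - y"] by (simp add: algebra_simps)
  then show "pos (x + y)" unfolding pos_def using st by (intro conjI exI[of _ "s+t"]) auto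
qed

lemma pos_0 [simp]: "pos 0" unfolding pos_def by (auto intro: exI[of _ 0])

lemma pos_scaleR: "pos x \<Longrightarrow> r \<ge> 0 \<Longrightarrow> pos (r *\<^sub>R x)"
proof -
  assume x: "pos x" and r: "r \<ge> 0"
  then obtain s where s: "s \<ge> 0" "norm (s *\<^sub>R 1 - x) \<le> s" "star x = x" unfolding pos_def by blast
  have "(r * s) *\<^sub>R 1 - r *\<^sub>R x = r *\<^sub>R (s *\<^sub>R 1 - x)" by (simp add: algebra_simps)
  then have "norm ((r * s) *\<^sub>R 1 - r *\<^sub>R x) \<le> r * s" using r s by (simp add: mult_left_mono)
  then show ?thesis unfolding pos_def using r s by (intro conjI exI[of _ "r * s"]) auto
qed

lemma pos_one [simp]: "pos 1" unfolding pos_def by (auto intro: exI[of _ 1])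

lemma pos_of_norm_le: "star y = y \<Longrightarrow> norm y \<le> t \<Longrightarrow> pos (t *\<^sub>R 1 - y)"
  using norm_ge_zero[of y] unfolding pos_def by (intro conjI exI[of _ t]) (auto simp del: norm_ge_zero)

lemma pos_sqrt:
  fixes h :: "'a::cstar_algebra_1"
  assumes "pos h"
  obtains b where "star b = b" "pos b" "b * b = h"
    "\<And>A. closed_subalgebra A \<Longrightarrow> h \<in> A \<Longrightarrow> b \<in> A"
proof -
  obtain t where t: "t \<ge> 0" "norm (t *\<^sub>R 1 - h) \<le> t" "star h = h"
    using assms unfolding pos_def by blast
  show thesis
  proof (cases "t = 0")
    case True
    then have "h = 0" using t by simp
    then show ?thesis using that[of 0] by (auto simp: closed_subalgebra_def subspace_0)
  next
    case False
    then have t0: "t > 0" using t by simp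
    define z where "z = 1 - (1/t) *\<^sub>R h"
    have "z = (1/t) *\<^sub>R (t *\<^sub>R 1 - h)" using t0 by (simp add: z_def algebra_simps)
    then have z: "norm z \<le> 1" using t t0 by (simp add: divide_simps)
    obtain b where b: "star b = b" "b * b = 1 - z" "norm (1 - b) \<le> 1"
      "\<And>A. closed_subalgebra A \<Longrightarrow> z \<in> A \<Longrightarrow> b \<in> A"
      using ex_sqrt_one_minus[OF z] t unfolding z_def by auto
    have pb: "pos b" unfolding pos_def using b by (intro conjI exI[of _ 1]) auto
    show ?thesis
    proof (rule that[of "sqrt t *\<^sub>R b"])
      show "pos (sqrt t *\<^sub>R b)" using pb t by (simp add: pos_scaleR)
      show "(sqrt t *\<^sub>R b) * (sqrt t *\<^sub>R b) = h" using b t0 by (simp add: z_def)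
      show "sqrt t *\<^sub>R b \<in> A" if "closed_subalgebra A" "h \<in> A" for A
        using that b(4)[of A] unfolding closed_subalgebra_def z_def
        by (auto intro!: subspace_scale subspace_diff)
    qed (use b in auto)
  qed
qed

lemma pos_sqrt_commute:
  fixes h :: "'a::cstar_algebra_1"
  assumes "pos h"
  obtains b where "star b = b" "pos b" "b * b = h" "\<And>y. h * y = y * h \<Longrightarrow> b * y = y * b"
proof -
  obtain b where b: "star b = b" "pos b" "b * b = h"
    "\<And>A. closed_subalgebra A \<Longrightarrow> h \<in> A \<Longrightarrow> b \<in> A"
    using pos_sqrt[OF assms] by blast
  have "b * y = y * b" if "h * y = y * h" for y
    using b(4)[OF closed_subalgebra_commutant[of y]] that by simp
  then show thesis using that b by blast
qed

text \<open>
  After scaling, \<open>b * b = 1 - k * k\<close> has a solution \<open>b\<close> commuting with \<open>k\<close>, and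
  \<open>norm_diff_squares_le\<close> bounds \<open>1 - 2 *\<^sub>R (k * k)\<close> by 1.
\<close>

lemma pos_square:
  fixes k :: "'a::cstar_algebra_1"
  assumes k: "star k = k"
  shows "pos (k * k)"
proof -
  have *: "pos (k * k)" if k: "star k = k" and n: "norm k \<le> 1" for k :: 'a
  proof -
    have "norm (k * k) \<le> 1" using n by (simp add: norm_square_selfadjoint[OF k] power_le_one)
    then have "pos (1 - k * k)" using pos_of_norm_le[of "k * k" 1] k by simp
    then obtain b where b: "star b = b" "b * b = 1 - k * k"
        "\<And>y. (1 - k * k) * y = y * (1 - k * k) \<Longrightarrow> b * y = y * b"
      using pos_sqrt_commute by metis
    have "b * k = k * b" by (rule b(3)) (simp add: algebra_simps)
    then have "norm (b * b - k * k) \<le> norm (b * b + k * k)"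
      by (rule norm_diff_squares_le[OF b(1) k])
    then have "norm (1 - 2 *\<^sub>R (k * k)) \<le> 1" by (simp add: b(2) scaleR_2 algebra_simps)
    then have "pos (2 *\<^sub>R (k * k))" unfolding pos_def using k by (intro conjI exI[of _ 1]) auto
    from pos_scaleR[OF this, of "1/2"] show ?thesis by simp
  qed
  define c where "c = norm k + 1"
  have c: "c > 0" by (simp add: c_def add_nonneg_pos)
  have "norm ((1/c) *\<^sub>R k) \<le> 1" using c by (simp add: c_def divide_simps)
  then have "pos (((1/c) *\<^sub>R k) * ((1/c) *\<^sub>R k))" by (intro *) (simp add: k)
  from pos_scaleR[OF this, of "c * c"] show ?thesis using c by simp
qed

text \<open>
  Both hypotheses have square roots, which commute with each other, and \<open>2 *\<^sub>R y\<close> is the difference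
  of their squares while \<open>(2 * t) *\<^sub>R 1\<close> is the sum.
\<close>

lemma norm_le_of_sandwich:
  fixes y :: "'a::cstar_algebra_1"
  assumes "t \<ge> 0" "pos (t *\<^sub>R 1 - y)" "pos (t *\<^sub>R 1 + y)"
  shows "norm y \<le> t"
proof -
  obtain r where r: "star r = r" "r * r = t *\<^sub>R 1 + y"
    "\<And>z. (t *\<^sub>R 1 + y) * z = z * (t *\<^sub>R 1 + y) \<Longrightarrow> r * z = z * r"
    using pos_sqrt_commute[OF assms(3)] by metis
  obtain s where s: "star s = s" "s * s = t *\<^sub>R 1 - y"
    "\<And>z. (t *\<^sub>R 1 - y) * z = z * (t *\<^sub>R 1 - y) \<Longrightarrow> s * z = z * s"
    using pos_sqrt_commute[OF assms(2)] by metis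
  have "r * y = y * r" by (rule r(3)) (simp add: algebra_simps)
  then have "s * r = r * s" by (intro s(3)) (simp add: algebra_simps)
  then have "norm (r * r - s * s) \<le> norm (r * r + s * s)"
    using norm_diff_squares_le[OF r(1) s(1)] by simp
  then show ?thesis using assms(1) by (simp add: r(2) s(2) algebra_simps flip: scaleR_2)
qed

lemma norm_le_of_pos:
  fixes x :: "'a::cstar_algebra_1"
  assumes "t \<ge> 0" "pos x" "pos (t *\<^sub>R 1 - x)"
  shows "norm x \<le> t"
  by (rule norm_le_of_sandwich) (use assms pos_add[OF pos_scaleR[OF pos_one]] in auto)

lemma norm_mono_pos:
  fixes x y :: "'a::cstar_algebra_1"
  assumes "pos x" "pos (y - x)" shows "norm x \<le> norm y"
proof (rule norm_le_of_pos)
  have "pos y" using pos_add[OF assms] by simp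
  then have "pos (norm y *\<^sub>R 1 - y)" by (intro pos_of_norm_le) (auto simp: pos_def)
  from pos_add[OF this assms(2)] show "pos (norm y *\<^sub>R 1 - x)" by simp
qed (use assms in auto)

lemma pos_power: "pos q \<Longrightarrow> pos (q ^ n)" for q :: "'a::cstar_algebra_1"
proof -
  assume "pos q"
  then obtain r where r: "star r = r" "r * r = q" by (metis pos_sqrt)
  have "q ^ n = r ^ n * r ^ n"
    by (metis r(2) power2_eq_square power_add power_mult mult.commute mult_2)
  then show ?thesis using pos_square[of "r ^ n"] r by simp
qed

lemma pos_power_times_one_plus_power:
  fixes q :: "'a::cstar_algebra_1"
  assumes "pos q"
  shows "pos (q ^ k * (1 + q) ^ n)"
proof (induction n arbitrary: k)
  case 0 then show ?case using pos_power[OF assms] by simp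
next
  case (Suc n)
  have "q ^ k * (1 + q) ^ Suc n = q ^ k * (1 + q) ^ n + q ^ Suc k * (1 + q) ^ n"
    unfolding power_Suc2[of q k] by (simp add: algebra_simps)
  then show ?case using pos_add[OF Suc[of k] Suc[of "Suc k"]] by simp
qed

text \<open>
  The products \<open>q * (1 + q) ^ n\<close> dominate \<open>real n *\<^sub>R q\<^sup>2\<close>, so they can stay bounded only if
  \<open>q\<^sup>2 = 0\<close>.
\<close>

lemma power_bounded_pos_zero:
  fixes q :: "'a::cstar_algebra_1"
  assumes q: "pos q" and B: "\<And>n. norm (q * (1 + q) ^ n) \<le> B"
  shows "q = 0"
proof -
  have 1: "pos (q\<^sup>2 * (1 + q) ^ n - q\<^sup>2)" for n
  proof (induction n)
    case (Suc n)
    have "q\<^sup>2 * (1 + q) ^ Suc n - q\<^sup>2 = (q\<^sup>2 * (1 + q) ^ n - q\<^sup>2) + q ^ 3 * (1 + q) ^ n"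
      by (simp add: power2_eq_square power3_eq_cube algebra_simps)
    then show ?case using pos_add[OF Suc pos_power_times_one_plus_power[OF q]] by metis
  qed simp
  have 2: "pos (q * (1 + q) ^ n - real n *\<^sub>R q\<^sup>2)" for n
  proof (induction n)
    case (Suc n)
    have "q * (1 + q) ^ Suc n - real (Suc n) *\<^sub>R q\<^sup>2
        = (q * (1 + q) ^ n - real n *\<^sub>R q\<^sup>2) + (q\<^sup>2 * (1 + q) ^ n - q\<^sup>2)"
      by (simp add: power2_eq_square algebra_simps)
    then show ?case using pos_add[OF Suc 1] by metis
  qed (use q in simp)
  have "real n * norm (q\<^sup>2) \<le> B" for n
    using norm_mono_pos[OF pos_scaleR[OF pos_power[OF q, of 2], of "real n"] 2[of n]] B[of n] by simp
  then have "norm (q\<^sup>2) = 0"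
    by (metis norm_ge_zero order_le_less reals_Archimedean3 not_le)
  then show ?thesis
    using norm_square_selfadjoint[OF pos_star[OF q]] by (simp add: power2_eq_square)
qed

text \<open>
  Writing \<open>b = x + \<i> y\<close> with \<open>x\<close>, \<open>y\<close> self-adjoint, \<open>star b * b + b * star b\<close> is
  \<open>2 *\<^sub>R (x * x + y * y)\<close>, so \<open>b * star b\<close> is positive. The classical argument now compares the
  nonzero spectra of \<open>star b * b\<close> and \<open>b * star b\<close>. Here the intertwining
  \<open>(1 + q) ^ n * star b = star b * (1 - b * star b) ^ n\<close> with \<open>q = - (star b * b)\<close> is used
  instead: its right side stays bounded, so \<open>q = 0\<close>.
\<close>

lemma star_mult_self_neg_pos:
  fixes b :: "'a::cstar_algebra_1"
  assumes neg: "pos (- (star b * b))"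
  shows "b = 0"
proof -
  have *: "b = 0" if neg: "pos (- (star b * b))" and n: "norm b \<le> 1" for b :: 'a
  proof -
    define x where "x = (1/2) *\<^sub>R (b + star b)"
    define y where "y = - ((1/2) *\<^sub>R (\<i> *\<^sub>C (b - star b)))"
    have sx: "star x = x" and sy: "star y = y"
      using complex_vector.scale_minus_left[of \<i> "star b - b"]
      by (simp_all add: x_def y_def star_scaleC algebra_simps scaleC_diff_right)
    have xx: "2 *\<^sub>R (x * x) = (1/2) *\<^sub>R ((b + star b) * (b + star b))" by (simp add: x_def)
    have yy: "2 *\<^sub>R (y * y) = - ((1/2) *\<^sub>R ((b - star b) * (b - star b)))"
      by (simp add: y_def mult_scaleC_left mult_scaleC_right scaleC_scaleR_commute scaleC_scaleC
        complex_vector.scale_minus_left)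
    have "2 *\<^sub>R (x * x) + 2 *\<^sub>R (y * y) = (1/2) *\<^sub>R (2 *\<^sub>R (b * star b + star b * b))"
      unfolding xx yy scaleR_right_diff_distrib[symmetric] diff_conv_add_uminus[symmetric]
      by (simp add: algebra_simps scaleR_2)
    then have eq: "b * star b = 2 *\<^sub>R (x * x) + 2 *\<^sub>R (y * y) + (- (star b * b))"
      by simp
    have c: "pos (b * star b)"
      unfolding eq by (intro pos_add pos_scaleR pos_square sx sy neg) auto
    have "norm (b * star b) \<le> 1"
      using cstar_identity[of "star b"] n by (simp add: power_le_one)
    moreover have "pos (1 - b * star b)" "norm (1 - b * star b) \<le> 1" if "norm (b * star b) \<le> 1"
    proof -
      show 1: "pos (1 - b * star b)" using pos_of_norm_le[of "b * star b" 1] that by simp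
      show "norm (1 - b * star b) \<le> 1" using norm_le_of_pos[of 1 "1 - b * star b"] 1 c by simp
    qed
    ultimately have le1: "norm (1 - b * star b) \<le> 1" by blast
    define q where "q = - (star b * b)"
    have comm: "(1 + q) ^ n * star b = star b * (1 - b * star b) ^ n" for n
    proof (induction n)
      case (Suc n)
      have "(1 + q) ^ Suc n * star b = (1 + q) * ((1 + q) ^ n * star b)" by (simp add: mult.assoc)
      also have "\<dots> = (1 + q) * star b * (1 - b * star b) ^ n" using Suc by (simp add: mult.assoc)
      also have "(1 + q) * star b = star b * (1 - b * star b)" by (simp add: q_def algebra_simps)
      finally show ?case by (simp add: mult.assoc)
    qed simp
    have "norm (q * (1 + q) ^ n) \<le> 1" for n
    proof -
      have "q * (1 + q) ^ n = (1 + q) ^ n * q"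
        by (metis power_commutes power_commuting_commutes distrib_left distrib_right mult.left_neutral mult.right_neutral)
      also have "\<dots> = - (((1 + q) ^ n * star b) * b)" by (simp add: q_def mult.assoc)
      also have "norm \<dots> = norm (star b * (1 - b * star b) ^ n * b)" by (simp add: comm)
      also have "\<dots> \<le> norm (star b) * norm ((1 - b * star b) ^ n) * norm b"
        by (meson norm_mult_ineq mult_right_mono norm_ge_zero order_trans)
      also have "\<dots> \<le> 1 * 1 * 1"
        by (intro mult_mono mult_nonneg_nonneg)
           (use n le1 norm_power_ineq[of "1 - b * star b" n] power_le_one[OF norm_ge_zero le1, of n] in auto)
      finally show ?thesis by simp
    qed
    then have "q = 0" using power_bounded_pos_zero[of q 1] neg q_def by blast
    then show "b = 0" using cstar_identity[of b] by (simp add: q_def)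
  qed
  define c where "c = norm b + 1"
  have c: "c > 0" by (simp add: c_def add_nonneg_pos)
  have "pos (- (star ((1/c) *\<^sub>R b) * ((1/c) *\<^sub>R b)))"
    using pos_scaleR[OF neg, of "1 / (c*c)"] by simp
  moreover have "norm ((1/c) *\<^sub>R b) \<le> 1" using c by (simp add: c_def divide_simps)
  ultimately have "(1/c) *\<^sub>R b = 0" by (rule *)
  then show ?thesis using c by simp
qed

text \<open>
  The theorem of Kelley and Vaught. With \<open>m\<close> playing the role of the absolute value of
  \<open>h = star a * a\<close>, the element \<open>n\<close> is the negative part of \<open>h\<close>; then
  \<open>star (a * n) * (a * n) = - n ^ 3\<close>, and \<open>n ^ 3\<close> is the square of \<open>g * n\<close>, where \<open>g * g = m\<close>. The
  previous lemma gives \<open>a * n = 0\<close>, hence \<open>n = 0\<close>.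
\<close>

lemma pos_star_mult_self: "pos (star a * a)" for a :: "'a::cstar_algebra_1"
proof -
  define h where "h = star a * a"
  have sh: "star h = h" by (simp add: h_def)
  obtain m where m: "star m = m" "pos m" "m * m = h * h"
      "\<And>y. h * h * y = y * (h * h) \<Longrightarrow> m * y = y * m"
    using pos_sqrt_commute[OF pos_square[OF sh]] by metis
  have mh: "m * h = h * m" by (rule m(4)) (simp add: mult.assoc)
  obtain g where g: "star g = g" "g * g = m" "\<And>y. m * y = y * m \<Longrightarrow> g * y = y * g"
    using pos_sqrt_commute[OF m(2)] by metis
  have gh: "g * h = h * g" by (rule g(3)) (rule mh)
  have gm: "g * m = m * g" by (rule g(3)) simp
  \<comment> \<open>\<open>n\<close> is the negative part of \<open>h\<close>: \<open>n * n = m * n\<close> and \<open>h * n = - (n * n)\<close>.\<close>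
  define n where "n = (1/2) *\<^sub>R (m - h)"
  have sn: "star n = n" by (simp add: n_def m(1) sh)
  have gn: "g * n = n * g" using gh gm by (simp add: n_def algebra_simps)
  have nn: "n * n = m * n"
    using m(3) mh by (simp add: n_def algebra_simps flip: scaleR_add_left)
  have hn: "h * n = - (n * n)"
    using m(3) mh by (simp add: n_def algebra_simps flip: scaleR_add_left)
  have "star (a * n) * (a * n) = n * (h * n)" by (simp add: h_def sn mult.assoc)
  also have "\<dots> = - (n * (g * g * n))" by (simp add: hn nn g(2))
  also have "\<dots> = - ((g * n) * (g * n))" using gn by (metis mult.assoc)
  finally have e: "star (a * n) * (a * n) = - ((g * n) * (g * n))" .
  have "star (g * n) = g * n" using gn by (simp add: sn g(1))
  then have "pos (- (star (a * n) * (a * n)))" unfolding e minus_minus by (rule pos_square)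
  then have "a * n = 0" by (rule star_mult_self_neg_pos)
  then have "h * n = 0" by (simp add: h_def mult.assoc)
  then have "n * n = 0" using hn by simp
  then have "n = 0" using norm_square_selfadjoint[OF sn] by simp
  then have "m = h" by (simp add: n_def)
  then show ?thesis using m(2) h_def by simp
qed

lemma pos_conjugate:
  fixes a x :: "'a::cstar_algebra_1"
  assumes "pos x" shows "pos (star a * x * a)"
proof -
  obtain b where "star b = b" "b * b = x" using pos_sqrt[OF assms] by metis
  then have "star a * x * a = star (b * a) * (b * a)" by (auto simp: mult.assoc)
  then show ?thesis using pos_star_mult_self by metis
qed

section \<open>Hahn-Banach extension below a sublinear functional\<close>

definition sublinear :: "('a::real_vector \<Rightarrow> real) \<Rightarrow> bool" where
  "sublinear q \<longleftrightarrow> (\<forall>x y. q (x + y) \<le> q x + q y) \<and> (\<forall>r>0. \<forall>x. q (r *\<^sub>R x) \<le> r * q x)"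

lemma sublinear_add: "sublinear q \<Longrightarrow> q (x + y) \<le> q x + q y"
  by (simp add: sublinear_def)

lemma sublinear_scale: assumes "sublinear q" "r > 0" shows "q (r *\<^sub>R x) = r * q x"
proof (rule antisym)
  show "q (r *\<^sub>R x) \<le> r * q x" using assms by (simp add: sublinear_def)
  have "q ((1/r) *\<^sub>R (r *\<^sub>R x)) \<le> (1/r) * q (r *\<^sub>R x)"
    using assms unfolding sublinear_def by (metis zero_less_divide_1_iff)
  then show "r * q x \<le> q (r *\<^sub>R x)" using assms(2) by (simp add: field_simps)
qed

lemma sublinear_zero: assumes "sublinear q" shows "q 0 = 0"
  using sublinear_scale[OF assms, of 2 0] by simp

lemma sublinear_neg: "sublinear q \<Longrightarrow> - q (- x) \<le> q x"
  using sublinear_add[of q x "- x"] sublinear_zero[of q] by simp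

text \<open>
  A sublinear functional below \<open>q\<close> that is as small as possible in the direction \<open>- y\<close>: its value at
  \<open>- y\<close> is at most \<open>- q y\<close>. A minimal sublinear functional equals all its own \<open>line_inf\<close>s and is
  therefore additive.
\<close>

definition line_inf :: "('a::real_vector \<Rightarrow> real) \<Rightarrow> 'a \<Rightarrow> 'a \<Rightarrow> real" where
  "line_inf q y x = (INF t\<in>{0..}. q (x + t *\<^sub>R y) - t * q y)"

lemma line_inf:
  fixes q :: "'a::real_vector \<Rightarrow> real"
  assumes q: "sublinear q"
  shows line_inf_le: "t \<ge> 0 \<Longrightarrow> line_inf q y x \<le> q (x + t *\<^sub>R y) - t * q y"
    and sublinear_line_inf: "sublinear (line_inf q y)"
proof -
  have bdd: "bdd_below ((\<lambda>t. q (x + t *\<^sub>R y) - t * q y) ` {0..})" for x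
  proof (rule bdd_belowI2)
    fix t :: real assume "t \<in> {0..}"
    then consider "t = 0" | "t > 0" by fastforce
    then show "- q (- x) \<le> q (x + t *\<^sub>R y) - t * q y"
    proof cases
      case 1 then show ?thesis using sublinear_neg[OF q] by simp
    next
      case 2
      show ?thesis using sublinear_add[OF q, of "x + t *\<^sub>R y" "- x"] sublinear_scale[OF q 2, of y] by simp
    qed
  qed
  show le: "line_inf q y x \<le> q (x + t *\<^sub>R y) - t * q y" if "t \<ge> 0" for x t
    unfolding line_inf_def by (rule cINF_lower[OF bdd]) (use that in simp)
  have ge: "c \<le> line_inf q y x" if "\<And>t. t \<ge> 0 \<Longrightarrow> c \<le> q (x + t *\<^sub>R y) - t * q y" for c x
    unfolding line_inf_def by (rule cINF_greatest) (use that in auto)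
  show "sublinear (line_inf q y)"
    unfolding sublinear_def
  proof (intro conjI allI impI)
    fix a b
    have "line_inf q y (a + b) - (q (a + s *\<^sub>R y) - s * q y) \<le> line_inf q y b" if s: "s \<ge> 0" for s
    proof (rule ge)
      fix t :: real assume t: "t \<ge> 0"
      have "line_inf q y (a + b) \<le> q ((a + b) + (s + t) *\<^sub>R y) - (s + t) * q y"
        using le s t by simp
      also have "(a + b) + (s + t) *\<^sub>R y = (a + s *\<^sub>R y) + (b + t *\<^sub>R y)" by (simp add: algebra_simps)
      finally show "line_inf q y (a + b) - (q (a + s *\<^sub>R y) - s * q y) \<le> q (b + t *\<^sub>R y) - t * q y"
        using sublinear_add[OF q, of "a + s *\<^sub>R y" "b + t *\<^sub>R y"] by (simp add: algebra_simps)
    qed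
    then have "line_inf q y (a + b) - line_inf q y b \<le> line_inf q y a"
      by (intro ge) (simp add: algebra_simps)
    then show "line_inf q y (a + b) \<le> line_inf q y a + line_inf q y b" by simp
  next
    fix r :: real and a assume r: "r > 0"
    have "line_inf q y (r *\<^sub>R a) / r \<le> line_inf q y a"
    proof (rule ge)
      fix t :: real assume t: "t \<ge> 0"
      have "line_inf q y (r *\<^sub>R a) \<le> q (r *\<^sub>R a + (r * t) *\<^sub>R y) - (r * t) * q y"
        using le r t by simp
      also have "r *\<^sub>R a + (r * t) *\<^sub>R y = r *\<^sub>R (a + t *\<^sub>R y)" by (simp add: algebra_simps)
      also have "q \<dots> = r * q (a + t *\<^sub>R y)" by (rule sublinear_scale[OF q r])
      finally show "line_inf q y (r *\<^sub>R a) / r \<le> q (a + t *\<^sub>R y) - t * q y"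
        using r by (simp add: field_simps)
    qed
    then show "line_inf q y (r *\<^sub>R a) \<le> r * line_inf q y a" using r by (simp add: field_simps)
  qed
qed

lemma ex_minimal_sublinear:
  fixes q :: "'a::real_vector \<Rightarrow> real"
  assumes q: "sublinear q"
  obtains p where "sublinear p" "p \<le> q" "\<And>p'. sublinear p' \<Longrightarrow> p' \<le> p \<Longrightarrow> p' = p"
proof -
  define S where "S = {p. sublinear p \<and> p \<le> q}"
  let ?R = "relation_of (\<lambda>p p'. p' \<le> p) S"
  have "\<exists>m\<in>S. \<forall>a\<in>S. a \<le> m \<longrightarrow> a = m"
  proof (rule predicate_Zorn)
    show "partial_order_on S ?R"
      by (auto simp: partial_order_on_def preorder_on_def relation_of_def refl_on_def trans_def antisym_def)
  next
    fix C assume C: "C \<in> Chains ?R"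
    then have CS: "C \<subseteq> S" and tot: "\<And>a b. a \<in> C \<Longrightarrow> b \<in> C \<Longrightarrow> a \<le> b \<or> b \<le> a"
      by (auto simp: Chains_def relation_of_def)
    show "\<exists>u\<in>S. \<forall>a\<in>C. u \<le> a"
    proof (cases "C = {}")
      case True then show ?thesis using q by (auto simp: S_def)
    next
      case False
      have sub: "sublinear p" and leq: "p x \<le> q x" if "p \<in> C" for p x
        using that CS by (auto simp: S_def le_fun_def)
      define u where "u = (\<lambda>x. INF p\<in>C. p x)"
      have bdd: "bdd_below ((\<lambda>p. p x) ` C)" for x
      proof (rule bdd_belowI2)
        fix p assume "p \<in> C"
        then show "- q (- x) \<le> p x" using sublinear_neg[OF sub, of p x] leq[of p "- x"] by simp
      qed
      have le: "u x \<le> p x" if "p \<in> C" for p x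
        unfolding u_def by (rule cINF_lower[OF bdd that])
      have ge: "c \<le> u x" if "\<And>p. p \<in> C \<Longrightarrow> c \<le> p x" for c x
        unfolding u_def by (rule cINF_greatest[OF False that])
      have "sublinear u" unfolding sublinear_def
      proof (intro conjI allI impI)
        fix x y
        have "u (x + y) - p x \<le> u y" if p: "p \<in> C" for p
        proof (rule ge)
          fix p' assume p': "p' \<in> C"
          have "\<exists>p''\<in>C. p'' \<le> p \<and> p'' \<le> p'" using tot[OF p p'] p p' by auto
          then obtain p'' where p'': "p'' \<in> C" "p'' x \<le> p x" "p'' y \<le> p' y" by (auto simp: le_fun_def)
          have "u (x + y) \<le> p'' (x + y)" using le p'' by simp
          also have "\<dots> \<le> p x + p' y" using sublinear_add[OF sub[OF p''(1)], of x y] p'' by simp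
          finally show "u (x + y) - p x \<le> p' y" by simp
        qed
        then have "u (x + y) - u y \<le> u x" by (intro ge) (simp add: algebra_simps)
        then show "u (x + y) \<le> u x + u y" by simp
      next
        fix r :: real and x assume r: "r > 0"
        have "u (r *\<^sub>R x) / r \<le> u x"
        proof (rule ge)
          fix p assume p: "p \<in> C"
          show "u (r *\<^sub>R x) / r \<le> p x"
            using le[OF p, of "r *\<^sub>R x"] sublinear_scale[OF sub[OF p] r] r by (simp add: field_simps)
        qed
        then show "u (r *\<^sub>R x) \<le> r * u x" using r by (simp add: field_simps)
      qed
      moreover have "u \<le> q"
      proof (rule le_funI)
        fix x obtain p where "p \<in> C" using False by blast
        then show "u x \<le> q x" using le[of p x] leq[of p x] by simp
      qed
      ultimately show ?thesis using le by (auto simp: S_def le_fun_def)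
    qed
  qed
  then obtain p where p: "p \<in> S" "\<And>a. a \<in> S \<Longrightarrow> a \<le> p \<Longrightarrow> a = p" by blast
  show thesis
    by (rule that[of p]) (use p in \<open>auto simp: S_def intro: order_trans\<close>)
qed

lemma hahn_banach_sublinear:
  fixes q :: "'a::real_vector \<Rightarrow> real"
  assumes q: "sublinear q"
  obtains g where "linear g" "\<And>x. g x \<le> q x" "g y = q y"
proof -
  obtain g where g: "sublinear g" "g \<le> line_inf q y"
      and min: "\<And>p'. sublinear p' \<Longrightarrow> p' \<le> g \<Longrightarrow> p' = g"
    using ex_minimal_sublinear[OF sublinear_line_inf[OF q, of y]] by blast
  have eq: "line_inf g z = g" for z
    by (rule min[OF sublinear_line_inf[OF g(1)]])
       (use line_inf_le[OF g(1), of 0] in \<open>auto simp: le_fun_def\<close>)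
  have add: "g (x + z) = g x + g z" for x z
    using line_inf_le[OF g(1), of 1 z x] sublinear_add[OF g(1), of x z] by (simp add: eq)
  have neg: "g (- x) = - g x" for x
    using add[of x "- x"] sublinear_zero[OF g(1)] by simp
  have "linear g"
  proof
    show "g (r *\<^sub>R x) = r *\<^sub>R g x" for r x
    proof (cases r "0::real" rule: linorder_cases)
      case less
      then show ?thesis using sublinear_scale[OF g(1), of "- r" x] neg[of "r *\<^sub>R x"] by simp
    qed (use sublinear_scale[OF g(1)] sublinear_zero[OF g(1)] in auto)
  qed (rule add)
  moreover have gq: "g x \<le> q x" for x
    using g(2) line_inf_le[OF q, of 0 y x] by (auto simp: le_fun_def intro: order_trans)
  moreover have "g y = q y"
  proof (rule antisym[OF gq])
    have "g (- y) \<le> line_inf q y (- y)" using g(2) by (simp add: le_fun_def)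
    also have "\<dots> \<le> - q y"
      using line_inf_le[OF q, of 1 y "- y"] sublinear_zero[OF q] by simp
    finally show "q y \<le> g y" by (simp add: neg)
  qed
  ultimately show thesis by (rule that)
qed

section \<open>Positive functionals and states\<close>

lemma csubspace_scaleR: "csubspace A \<Longrightarrow> x \<in> A \<Longrightarrow> r *\<^sub>R x \<in> A"
  by (simp add: scaleR_scaleC complex_vector.subspace_scale)

lemma csubspace_imp_subspace: "csubspace A \<Longrightarrow> subspace A"
  by (auto simp: subspace_def csubspace_scaleR complex_vector.subspace_0 complex_vector.subspace_add)

definition complex_linear_on :: "'a::cstar_algebra_1 set \<Rightarrow> ('a \<Rightarrow> complex) \<Rightarrow> bool" where
  "complex_linear_on A \<phi> \<longleftrightarrow> (\<forall>x\<in>A. \<forall>y\<in>A. \<phi> (x + y) = \<phi> x + \<phi> y) \<and> (\<forall>c. \<forall>x\<in>A. \<phi> (c *\<^sub>C x) = c * \<phi> x)"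

lemma complex_linear_on_add: "complex_linear_on A \<phi> \<Longrightarrow> x \<in> A \<Longrightarrow> y \<in> A \<Longrightarrow> \<phi> (x + y) = \<phi> x + \<phi> y"
  and complex_linear_on_scaleC: "complex_linear_on A \<phi> \<Longrightarrow> x \<in> A \<Longrightarrow> \<phi> (c *\<^sub>C x) = c * \<phi> x"
  and complex_linear_on_scaleR: "complex_linear_on A \<phi> \<Longrightarrow> x \<in> A \<Longrightarrow> \<phi> (r *\<^sub>R x) = of_real r * \<phi> x"
  by (auto simp: complex_linear_on_def scaleR_scaleC)

lemma complex_linear_on_diff:
  assumes "complex_linear_on A \<phi>" "csubspace A" "x \<in> A" "y \<in> A"
  shows "\<phi> (x - y) = \<phi> x - \<phi> y"
proof -
  have "x - y = x + (-1) *\<^sub>R y" by simp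
  then show ?thesis using assms complex_linear_on_add complex_linear_on_scaleR
    by (metis (no_types, lifting) csubspace_scaleR mult_minus1 of_real_1 of_real_minus uminus_add_conv_diff add.commute)
qed

lemma complex_linear_on_zero:
  assumes "complex_linear_on A \<phi>" "csubspace A" shows "\<phi> 0 = 0"
  using complex_linear_on_diff[OF assms, of 0 0] complex_vector.subspace_0[OF assms(2)] by simp

locale unital_subalgebra =
  fixes A :: "'a::cstar_algebra_1 set"
  assumes cstar: "cstar_subalgebra A" and one [simp]: "1 \<in> A"
begin

lemma csub: "csubspace A" and mult [simp]: "x \<in> A \<Longrightarrow> y \<in> A \<Longrightarrow> x * y \<in> A"
  and star_mem [simp]: "x \<in> A \<Longrightarrow> star x \<in> A" and closed: "closed A"
  using cstar by (auto simp: cstar_subalgebra_def)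

lemma add_mem [simp]: "x \<in> A \<Longrightarrow> y \<in> A \<Longrightarrow> x + y \<in> A"
  and diff_mem [simp]: "x \<in> A \<Longrightarrow> y \<in> A \<Longrightarrow> x - y \<in> A"
  and scaleC_mem [simp]: "x \<in> A \<Longrightarrow> c *\<^sub>C x \<in> A"
  and scaleR_mem [simp]: "x \<in> A \<Longrightarrow> r *\<^sub>R x \<in> A"
  and zero_mem [simp]: "0 \<in> A"
  and minus_mem [simp]: "x \<in> A \<Longrightarrow> - x \<in> A"
  using csub by (simp_all add: complex_vector.subspace_add complex_vector.subspace_diff
    complex_vector.subspace_scale csubspace_scaleR complex_vector.subspace_0 complex_vector.subspace_neg)

lemma closed_subalgebra: "closed_subalgebra A"
  using csub closed by (auto simp: closed_subalgebra_def csubspace_imp_subspace)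

lemma power_mem [simp]: "x \<in> A \<Longrightarrow> x ^ n \<in> A"
  by (rule closed_subalgebra_power[OF closed_subalgebra])

lemma sqrt_mem: assumes "pos h" "h \<in> A" obtains b where "b \<in> A" "star b = b" "b * b = h"
  using pos_sqrt[OF assms(1)] closed_subalgebra assms(2) by metis

end

lemma unital_subalgebra_UNIV: "unital_subalgebra (UNIV :: 'a::cstar_algebra_1 set)"
  by unfold_locales (simp_all add: cstar_subalgebra_def)

definition positive_functional :: "'a::cstar_algebra_1 set \<Rightarrow> ('a \<Rightarrow> complex) \<Rightarrow> bool" where
  "positive_functional A \<sigma> \<longleftrightarrow> complex_linear_on A \<sigma> \<and> (\<forall>a\<in>A. \<sigma> (star a * a) \<in> \<real>\<^sub>\<ge>\<^sub>0)"

text \<open>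
  The discriminant argument for Cauchy-Schwarz, in the form that also covers \<open>b = 0\<close>.
\<close>

lemma quadratic_nonneg_imp_discriminant:
  fixes a b p :: real
  assumes "\<And>s. 0 \<le> a - 2 * s * p\<^sup>2 + s\<^sup>2 * p\<^sup>2 * b" "b \<ge> 0"
  shows "p\<^sup>2 \<le> a * b"
proof (cases "b = 0")
  case True
  have "p = 0"
  proof (rule ccontr)
    assume "p \<noteq> 0"
    then show False using assms(1)[of "(a + 1) / (2 * p\<^sup>2)"] True by (simp add: field_simps)
  qed
  then show ?thesis using True by simp
next
  case False
  then have "b > 0" using assms(2) by simp
  then show ?thesis using assms(1)[of "1/b"] by (simp add: field_simps power2_eq_square)
qed

context unital_subalgebra
begin

context
  fixes \<sigma> :: "'a \<Rightarrow> complex"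
  assumes pf: "positive_functional A \<sigma>"
begin

lemma pf_linear: "complex_linear_on A \<sigma>" using pf by (simp add: positive_functional_def)

lemma pf_pos: assumes "pos h" "h \<in> A" shows "Im (\<sigma> h) = 0" "Re (\<sigma> h) \<ge> 0"
proof -
  obtain b where "b \<in> A" "star b = b" "b * b = h" using sqrt_mem[OF assms] by blast
  then have "\<sigma> h \<in> \<real>\<^sub>\<ge>\<^sub>0" using pf unfolding positive_functional_def by metis
  then show "Im (\<sigma> h) = 0" "Re (\<sigma> h) \<ge> 0" by (auto simp: complex_nonneg_Reals_iff)
qed

lemma pf_hermitian:
  assumes x: "x \<in> A" shows "\<sigma> (star x) = cnj (\<sigma> x)"
proof -
  have sa: "Im (\<sigma> h) = 0" if h: "h \<in> A" "star h = h" for h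
  proof -
    have "pos (norm h *\<^sub>R 1 - h)" using pos_of_norm_le h(2) by blast
    then have "Im (\<sigma> (norm h *\<^sub>R 1 - h)) = 0" using pf_pos h by simp
    moreover have "Im (\<sigma> 1) = 0" using pf_pos by simp
    ultimately show ?thesis
      using h by (simp add: complex_linear_on_diff[OF pf_linear csub] complex_linear_on_scaleR[OF pf_linear])
  qed
  have "Im (\<sigma> (x + star x)) = 0" using x by (intro sa) (auto simp: add.commute)
  moreover have "Im (\<sigma> (\<i> *\<^sub>C (x - star x))) = 0"
    using x complex_vector.scale_minus_left[of \<i> "star x - x"]
    by (intro sa) (auto simp: star_scaleC scaleC_diff_right complex_vector.scale_minus_left)
  ultimately show ?thesis using x
    by (simp add: complex_eq_iff complex_linear_on_add[OF pf_linear] complex_linear_on_diff[OF pf_linear csub]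
      complex_linear_on_scaleC[OF pf_linear])
qed

lemma pf_cauchy_schwarz:
  assumes x: "x \<in> A" and y: "y \<in> A"
  shows "(norm (\<sigma> (star x * y)))\<^sup>2 \<le> Re (\<sigma> (star x * x)) * Re (\<sigma> (star y * y))"
proof (rule quadratic_nonneg_imp_discriminant)
  define p where "p = \<sigma> (star x * y)"
  fix s :: real
  \<comment> \<open>The phase of \<open>l\<close> makes the cross terms real and negative.\<close>
  define l where "l = - of_real s * cnj p"
  define z where "z = x + l *\<^sub>C y"
  have p': "\<sigma> (star y * x) = cnj p" using pf_hermitian[of "star x * y"] x y by (simp add: p_def)
  have "star z * z = star x * x + l *\<^sub>C (star x * y) + (cnj l *\<^sub>C (star y * x) + (cnj l * l) *\<^sub>C (star y * y))"
    by (simp add: z_def star_scaleC mult_scaleC_left mult_scaleC_right scaleC_scaleC algebra_simps scaleC_add_right)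
  then have e: "\<sigma> (star z * z) = \<sigma> (star x * x) + l * p + (cnj l * cnj p + cnj l * l * \<sigma> (star y * y))"
    using x y by (simp add: complex_linear_on_add[OF pf_linear] complex_linear_on_scaleC[OF pf_linear] p' p_def[symmetric])
  define a where "a = - s * (norm p)\<^sup>2"
  define b where "b = s\<^sup>2 * (norm p)\<^sup>2"
  have "l * p = of_real a" "cnj l * cnj p = of_real a" "cnj l * l = of_real b"
    unfolding l_def a_def b_def of_real_mult complex_norm_square
    by (simp_all add: power2_eq_square algebra_simps)
  then have "Re (\<sigma> (star z * z)) = Re (\<sigma> (star x * x)) + a + (a + b * Re (\<sigma> (star y * y)))"
    by (simp add: e)
  moreover have "Re (\<sigma> (star z * z)) \<ge> 0"
  proof (rule pf_pos(2)[OF pos_star_mult_self])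
    have "z \<in> A" using x y by (simp add: z_def)
    then show "star z * z \<in> A" by simp
  qed
  ultimately show "0 \<le> Re (\<sigma> (star x * x)) - 2 * s * (norm (\<sigma> (star x * y)))\<^sup>2
      + s\<^sup>2 * (norm (\<sigma> (star x * y)))\<^sup>2 * Re (\<sigma> (star y * y))"
    by (simp add: p_def a_def b_def)
next
  show "0 \<le> Re (\<sigma> (star y * y))" using pf_pos(2)[OF pos_star_mult_self] y by simp
qed

lemma pf_star_mult_self_le:
  assumes y: "y \<in> A" shows "Re (\<sigma> (star y * y)) \<le> (norm y)\<^sup>2 * Re (\<sigma> 1)"
proof -
  have "pos ((norm y)\<^sup>2 *\<^sub>R 1 - star y * y)" by (rule pos_of_norm_le) (auto simp: cstar_identity)
  then have "Re (\<sigma> ((norm y)\<^sup>2 *\<^sub>R 1 - star y * y)) \<ge> 0" using pf_pos y by simp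
  then show ?thesis using y
    by (simp add: complex_linear_on_diff[OF pf_linear csub] complex_linear_on_scaleR[OF pf_linear])
qed

lemma pf_norm_le:
  assumes y: "y \<in> A" shows "norm (\<sigma> y) \<le> Re (\<sigma> 1) * norm y"
proof -
  have 1: "Re (\<sigma> 1) \<ge> 0" using pf_pos[of 1] by simp
  have "(norm (\<sigma> y))\<^sup>2 \<le> Re (\<sigma> 1) * Re (\<sigma> (star y * y))"
    using pf_cauchy_schwarz[of 1 y] y by simp
  also have "\<dots> \<le> Re (\<sigma> 1) * ((norm y)\<^sup>2 * Re (\<sigma> 1))"
    by (rule mult_left_mono[OF pf_star_mult_self_le[OF y] 1])
  also have "\<dots> = (Re (\<sigma> 1) * norm y)\<^sup>2" by (simp add: power2_eq_square)
  finally show ?thesis using 1 by (simp add: power2_le_iff_abs_le)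
qed

end

text \<open>
  By Cauchy-Schwarz a positive functional attains its norm at 1.
\<close>

lemma states_iff: "\<sigma> \<in> states A \<longleftrightarrow> \<sigma> \<in> extensional A \<and> positive_functional A \<sigma> \<and> \<sigma> 1 = 1"
proof -
  have *: "dual_norm A \<sigma> = Re (\<sigma> 1)" if pf: "positive_functional A \<sigma>"
    unfolding dual_norm_def
  proof (rule cSup_eq_maximum)
    have "norm (\<sigma> 1) = Re (\<sigma> 1)" using pf_pos[OF pf, of 1] by (simp add: cmod_eq_Re)
    then show "Re (\<sigma> 1) \<in> (\<lambda>x. norm (\<sigma> x)) ` {x \<in> A. norm x \<le> 1}"
      by (intro image_eqI[of _ _ 1]) auto
    fix r assume "r \<in> (\<lambda>x. norm (\<sigma> x)) ` {x \<in> A. norm x \<le> 1}"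
    then obtain x where "x \<in> A" "norm x \<le> 1" "r = norm (\<sigma> x)" by auto
    then show "r \<le> Re (\<sigma> 1)" using pf_norm_le[OF pf, of x] pf_pos[OF pf, of 1]
      by (metis mult.right_neutral mult_left_mono one order_trans pos_one)
  qed
  show ?thesis
  proof
    assume s: "\<sigma> \<in> states A"
    then have pf: "positive_functional A \<sigma>"
      by (auto simp: states_def cdual_def positive_functional_def complex_linear_on_def)
    moreover have "\<sigma> 1 = 1"
      using *[OF pf] s pf_pos[OF pf, of 1] by (simp add: states_def complex_eq_iff)
    ultimately show "\<sigma> \<in> extensional A \<and> positive_functional A \<sigma> \<and> \<sigma> 1 = 1"
      using s by (simp add: states_def cdual_def)
  next
    assume "\<sigma> \<in> extensional A \<and> positive_functional A \<sigma> \<and> \<sigma> 1 = 1"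
    then show "\<sigma> \<in> states A"
      using * pf_norm_le[of \<sigma>] unfolding states_def cdual_def positive_functional_def complex_linear_on_def
      by (auto intro: exI[of _ 1])
  qed
qed

end

section \<open>Characters of an abelian subalgebra\<close>

definition character :: "'a::cstar_algebra_1 set \<Rightarrow> ('a \<Rightarrow> complex) \<Rightarrow> bool" where
  "character D \<rho> \<longleftrightarrow> complex_linear_on D \<rho> \<and> (\<forall>x\<in>D. \<forall>y\<in>D. \<rho> (x * y) = \<rho> x * \<rho> y) \<and> \<rho> 1 = 1 \<and>
     (\<forall>x\<in>D. norm (\<rho> x) \<le> norm x)"

text \<open>
  Compressing by such elements localizes at the point \<open>\<rho>\<close> of the spectrum of \<open>D\<close>. In an abelian \<open>D\<close>
  products of them are again of this form, so finitely many conditions on them can be met at once.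
\<close>

definition peak :: "'a::cstar_algebra_1 set \<Rightarrow> ('a \<Rightarrow> complex) \<Rightarrow> 'a set" where
  "peak D \<rho> = {e\<in>D. star e = e \<and> norm e \<le> 1 \<and> \<rho> e = 1}"

locale abelian_unital_subalgebra = unital_subalgebra D for D :: "'a::cstar_algebra_1 set" +
  assumes commute: "x \<in> D \<Longrightarrow> y \<in> D \<Longrightarrow> x * y = y * x"
begin

context
  fixes \<rho> assumes char: "character D \<rho>"
begin

lemma char_linear: "complex_linear_on D \<rho>"
  and char_mult: "x \<in> D \<Longrightarrow> y \<in> D \<Longrightarrow> \<rho> (x * y) = \<rho> x * \<rho> y"
  and char_one: "\<rho> 1 = 1" and char_norm_le: "x \<in> D \<Longrightarrow> norm (\<rho> x) \<le> norm x"
  using char by (auto simp: character_def)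

lemmas char_simps =
  complex_linear_on_add[OF char_linear] complex_linear_on_scaleC[OF char_linear]
  complex_linear_on_scaleR[OF char_linear] complex_linear_on_diff[OF char_linear csub]
  complex_linear_on_zero[OF char_linear csub] char_one char_mult

text \<open>
  If \<open>\<rho> h\<close> had a nonzero imaginary part, then adding a large imaginary multiple of 1 to \<open>h\<close> would raise the
  square of \<open>norm (\<rho> h)\<close> faster than that of \<open>norm h\<close>.
\<close>

lemma char_selfadjoint_real:
  assumes h: "h \<in> D" "star h = h" shows "Im (\<rho> h) = 0"
proof (rule ccontr)
  assume b: "Im (\<rho> h) \<noteq> 0"
  \<comment> \<open>With this \<open>t\<close> the cross term \<open>2 * Im (\<rho> h) * t\<close> outweighs \<open>(norm h)\<^sup>2\<close>.\<close>
  define t where "t = (norm h)\<^sup>2 / Im (\<rho> h)"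
  define x where "x = h + (\<i> * of_real t) *\<^sub>C 1"
  have x: "x \<in> D" using h by (simp add: x_def)
  have sx: "star x = h - (\<i> * of_real t) *\<^sub>C 1"
    using h complex_vector.scale_minus_left[of "\<i> * of_real t" 1] by (simp add: x_def star_scaleC)
  have "star x * x = h * h + (t\<^sup>2) *\<^sub>R 1"
    unfolding sx by (simp add: x_def algebra_simps mult_scaleC_left mult_scaleC_right scaleC_scaleC
      scaleR_scaleC power2_eq_square complex_vector.scale_minus_left)
  then have "(norm x)\<^sup>2 \<le> norm (h * h) + norm ((t\<^sup>2) *\<^sub>R (1::'a))"
    by (metis cstar_identity norm_triangle_ineq)
  then have "(norm x)\<^sup>2 \<le> (norm h)\<^sup>2 + t\<^sup>2" using norm_square_selfadjoint[OF h(2)] by simp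
  moreover have "(norm (\<rho> x))\<^sup>2 \<le> (norm x)\<^sup>2" using char_norm_le[OF x] by (simp add: power_mono)
  moreover have "(norm (\<rho> x))\<^sup>2 = (Re (\<rho> h))\<^sup>2 + (Im (\<rho> h) + t)\<^sup>2"
    using h by (simp add: x_def char_simps cmod_power2)
  ultimately have "(Im (\<rho> h) + t)\<^sup>2 \<le> (norm h)\<^sup>2 + t\<^sup>2"
    by (smt (verit) zero_le_power2)
  then have "(Im (\<rho> h))\<^sup>2 + 2 * (Im (\<rho> h) * t) \<le> (norm h)\<^sup>2"
    by (simp add: power2_eq_square algebra_simps)
  then have "(Im (\<rho> h))\<^sup>2 + (norm h)\<^sup>2 \<le> 0" using b by (simp add: t_def)
  then show False using b by (smt (verit) zero_less_power2 zero_le_power2)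
qed

lemma char_star:
  assumes x: "x \<in> D" shows "\<rho> (star x) = cnj (\<rho> x)"
proof -
  have "Im (\<rho> (x + star x)) = 0" using x by (intro char_selfadjoint_real) (auto simp: add.commute)
  moreover have "Im (\<rho> (\<i> *\<^sub>C (x - star x))) = 0"
    using x by (intro char_selfadjoint_real) (auto simp: star_scaleC scaleC_diff_right complex_vector.scale_minus_left)
  ultimately show ?thesis using x by (simp add: complex_eq_iff char_simps)
qed

lemma char_positive_functional: "positive_functional D \<rho>"
  unfolding positive_functional_def
proof (intro conjI ballI)
  fix a assume "a \<in> D"
  then have "\<rho> (star a * a) = of_real ((norm (\<rho> a))\<^sup>2)"
    by (simp only: complex_norm_square) (simp add: char_mult char_star)
  then show "\<rho> (star a * a) \<in> \<real>\<^sub>\<ge>\<^sub>0" by (simp only: nonneg_Reals_of_real_iff) simp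
qed (rule char_linear)

text \<open>
  If \<open>\<rho>\<close> is a convex combination of \<open>\<sigma>\<close> and \<open>\<tau>\<close>, then \<open>\<sigma> (star k * k) = 0\<close> for \<open>k = d - \<rho> d\<close>, and
  Cauchy-Schwarz yields \<open>\<sigma> k = 0\<close>.
\<close>

lemma char_pure_state: "restrict \<rho> D \<in> pure_states D"
  unfolding pure_states_def
proof (intro CollectI conjI ballI allI impI)
  have "positive_functional D (restrict \<rho> D)"
    using char_positive_functional unfolding positive_functional_def complex_linear_on_def by simp
  then show "restrict \<rho> D \<in> states D" unfolding states_iff by (simp add: char_one)
next
  fix \<sigma> \<tau> and t :: real
  assume st: "\<sigma> \<in> states D" "\<tau> \<in> states D"
    and *: "0 < t \<and> t < 1 \<and> (\<forall>a\<in>D. restrict \<rho> D a = of_real t * \<sigma> a + of_real (1 - t) * \<tau> a)"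
  have eq: "\<sigma> = restrict \<rho> D" if st: "\<sigma> \<in> states D" "\<tau> \<in> states D" and t: "0 < t" "t < 1"
    and eq: "\<And>a. a \<in> D \<Longrightarrow> \<rho> a = of_real t * \<sigma> a + of_real (1 - t) * \<tau> a" for \<sigma> \<tau> and t :: real
  proof
    fix d
    have pf: "positive_functional D \<sigma>" "positive_functional D \<tau>" and 1: "\<sigma> 1 = 1"
      and ext: "\<sigma> \<in> extensional D"
      using st by (auto simp: states_iff)
    show "\<sigma> d = restrict \<rho> D d"
    proof (cases "d \<in> D")
      case d: True
      define k where "k = d - \<rho> d *\<^sub>C 1"
      have k: "k \<in> D" "\<rho> k = 0" using d by (auto simp: k_def char_simps)
      have "0 = Re (\<rho> (star k * k))" using k by (simp add: char_mult)
      also have "\<dots> = t * Re (\<sigma> (star k * k)) + (1 - t) * Re (\<tau> (star k * k))"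
        using eq[of "star k * k"] k by simp
      also have "\<dots> \<ge> t * Re (\<sigma> (star k * k))"
        using pf_pos(2)[OF pf(2) pos_star_mult_self, of k] k t by simp
      finally have "Re (\<sigma> (star k * k)) \<le> 0" using t by (simp add: mult_le_0_iff)
      moreover have "(norm (\<sigma> k))\<^sup>2 \<le> Re (\<sigma> (star k * k))"
        using pf_cauchy_schwarz[OF pf(1), of 1 k] k 1 by simp
      ultimately have "(norm (\<sigma> k))\<^sup>2 \<le> 0" by linarith
      then have "\<sigma> k = 0" by simp
      then show ?thesis using d 1
        by (simp add: k_def complex_linear_on_diff[OF pf_linear[OF pf(1)] csub] complex_linear_on_scaleC[OF pf_linear[OF pf(1)]])
    next
      case False then show ?thesis using ext by (simp add: extensional_def)
    qed
  qed
  show "\<sigma> = restrict \<rho> D" using eq[of \<sigma> \<tau> t] st * by auto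
  show "\<tau> = restrict \<rho> D" using eq[of \<tau> \<sigma> "1 - t"] st * by (auto simp: algebra_simps)
qed

lemma peak_one: "1 \<in> peak D \<rho>" by (simp add: peak_def char_one)

lemma peak_mem: "e \<in> peak D \<rho> \<Longrightarrow> e \<in> D" and peak_star: "e \<in> peak D \<rho> \<Longrightarrow> star e = e"
  and peak_norm: "e \<in> peak D \<rho> \<Longrightarrow> norm e \<le> 1" and peak_val: "e \<in> peak D \<rho> \<Longrightarrow> \<rho> e = 1"
  by (auto simp: peak_def)

lemma peak_mult: "e \<in> peak D \<rho> \<Longrightarrow> f \<in> peak D \<rho> \<Longrightarrow> e * f \<in> peak D \<rho>"
  using commute by (auto simp: peak_def char_mult intro!: order_trans[OF norm_mult_ineq mult_le_one])

text \<open>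
  A mean ergodic argument. Rescale \<open>star k * k\<close> to a positive contraction \<open>h\<close>; then \<open>S = 1 - 2 *\<^sub>R h\<close>
  is a contraction with \<open>\<rho> S = 1\<close>, and the average \<open>e\<close> of its first \<open>n\<close> powers satisfies
  \<open>e * (1 - S) = (1 / real n) *\<^sub>R (1 - S ^ n)\<close>, which tends to 0.
\<close>

lemma ex_peak_annihilating:
  assumes k: "k \<in> D" "\<rho> k = 0" and \<epsilon>: "\<epsilon> > 0"
  obtains e where "e \<in> peak D \<rho>" "norm (k * e) < \<epsilon>"
proof -
  define c where "c = (norm k)\<^sup>2 + 1"
  have c: "c > 0" by (simp add: c_def add_nonneg_pos)
  define h where "h = (1/c) *\<^sub>R (star k * k)"
  have ph: "pos h" unfolding h_def using c by (intro pos_scaleR pos_star_mult_self) simp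
  have "norm h \<le> 1" using c by (simp add: h_def cstar_identity c_def divide_simps)
  then have ph1: "pos (1 - h)" using pos_of_norm_le[of h 1] pos_star[OF ph] by simp
  have h: "h \<in> D" "\<rho> h = 0" "star h = h" using k pos_star[OF ph] by (simp_all add: h_def char_simps)
  define S where "S = 1 - 2 *\<^sub>R h"
  have S: "S \<in> D" "\<rho> S = 1" "star S = S" using h by (simp_all add: S_def char_simps)
  have nS: "norm S \<le> 1"
  proof (rule norm_le_of_sandwich)
    show "pos (1 *\<^sub>R 1 - S)" using pos_scaleR[OF ph, of 2] by (simp add: S_def)
    show "pos (1 *\<^sub>R 1 + S)" using pos_scaleR[OF ph1, of 2] by (simp add: S_def scaleR_2 algebra_simps)
  qed simp
  have nSj: "norm (S ^ j) \<le> 1" for j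
    using norm_power_ineq[of S j] power_le_one[OF norm_ge_zero nS, of j] by simp
  have rSj: "\<rho> (S ^ j) = 1" for j using S by (induction j) (auto simp: char_simps)
  obtain n :: nat where n: "n > 0" "c / n < \<epsilon>\<^sup>2"
  proof -
    obtain n :: nat where n: "c / \<epsilon>\<^sup>2 < n" using reals_Archimedean2 by blast
    have "0 < c / \<epsilon>\<^sup>2" using c \<epsilon> by simp
    then have "n > 0" using n by (cases n) auto
    then show thesis using that[of n] n \<epsilon> by (simp add: field_simps)
  qed
  define e where "e = (1 / real n) *\<^sub>R (\<Sum>j<n. S ^ j)"
  have sm: "(\<Sum>j<m. S ^ j) \<in> D" "\<rho> (\<Sum>j<m. S ^ j) = of_nat m" for m
    by (induction m) (use S rSj in \<open>auto simp: char_simps\<close>)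
  have star_sm: "star (\<Sum>j<m. S ^ j) = (\<Sum>j<m. S ^ j)" for m
    by (induction m) (use S in auto)
  have "norm (\<Sum>j<n. S ^ j) \<le> n" using sum_norm_le[of "{..<n}" "\<lambda>j. S ^ j" "\<lambda>_. 1"] nSj by simp
  then have e: "e \<in> peak D \<rho>"
    using sm n star_sm by (simp add: e_def peak_def char_simps divide_simps)
  have "(\<Sum>j<m. S ^ j) * (1 - S) = 1 - S ^ m" for m
  proof (induction m)
    case (Suc m)
    have "(\<Sum>j<Suc m. S ^ j) * (1 - S) = (\<Sum>j<m. S ^ j) * (1 - S) + S ^ m * (1 - S)"
      by (simp add: distrib_right)
    also have "\<dots> = 1 - S ^ Suc m" by (simp add: Suc) (simp add: right_diff_distrib power_commutes)
    finally show ?case .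
  qed simp
  then have "norm ((\<Sum>j<n. S ^ j) * (2 *\<^sub>R h)) \<le> 2"
    using norm_triangle_ineq4[of 1 "S ^ n"] nSj[of n] by (simp add: S_def)
  then have "norm ((\<Sum>j<n. S ^ j) * h) \<le> 1" by simp
  then have eh: "norm (e * h) \<le> 1 / n" using n by (simp add: e_def divide_simps)
  have "(norm (k * e))\<^sup>2 = norm (star (k * e) * (k * e))" by (rule cstar_identity[symmetric])
  also have "star (k * e) * (k * e) = c *\<^sub>R ((e * h) * e)"
    using peak_star[OF e] c by (simp add: h_def mult.assoc)
  also have "norm \<dots> \<le> c * (norm (e * h) * norm e)"
    using norm_mult_ineq[of "e * h" e] c by simp
  also have "\<dots> \<le> c * (1 / n * 1)"
    using eh peak_norm[OF e] c n by (intro mult_left_mono mult_mono) auto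
  also have "\<dots> < \<epsilon>\<^sup>2" using n by simp
  finally have "norm (k * e) < \<epsilon>" using \<epsilon> by (simp add: power_less_imp_less_base)
  then show thesis using that e by blast
qed

lemma ex_peak_eigen:
  assumes k: "k \<in> D" and \<epsilon>: "\<epsilon> > 0"
  obtains e where "e \<in> peak D \<rho>" "norm (k * e - \<rho> k *\<^sub>C e) < \<epsilon>"
proof -
  have "k - \<rho> k *\<^sub>C 1 \<in> D" "\<rho> (k - \<rho> k *\<^sub>C 1) = 0" using k by (auto simp: char_simps)
  from ex_peak_annihilating[OF this \<epsilon>] show thesis using that
    by (auto simp: algebra_simps mult_scaleC_left)
qed

lemma norm_mult_peak_le: "f \<in> peak D \<rho> \<Longrightarrow> norm (x * f) \<le> norm x"
  and norm_peak_mult_le: "f \<in> peak D \<rho> \<Longrightarrow> norm (f * x) \<le> norm x"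
  using mult_left_le[OF peak_norm[of f] norm_ge_zero[of x]] norm_mult_ineq[of x f] norm_mult_ineq[of f x]
  by (auto simp: mult.commute)

end

end

section \<open>Extension of characters to states, and excision\<close>

definition real_part :: "'a::cstar_algebra_1 \<Rightarrow> 'a" where
  "real_part x = (1/2) *\<^sub>R (x + star x)"

lemma real_part_simps [simp]:
  "real_part (x + y) = real_part x + real_part y" "real_part (r *\<^sub>R x) = r *\<^sub>R real_part x"
  "star (real_part x) = real_part x"
  by (simp_all add: real_part_def algebra_simps)

lemma real_part_selfadjoint: "star x = x \<Longrightarrow> real_part x = x"
  by (simp add: real_part_def flip: scaleR_2)

lemma norm_real_part_le: "norm (real_part x) \<le> norm x"
  using norm_triangle_ineq[of x "star x"] by (simp add: real_part_def)

context abelian_unital_subalgebra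
begin

text \<open>
  The values \<open>upper \<rho> x\<close> turn out to be the largest real parts at \<open>x\<close> of states extending \<open>\<rho>\<close>. The
  real part of \<open>x\<close> is built in so that \<open>upper \<rho>\<close> is defined on the whole algebra, regarded as a real
  vector space.
\<close>

definition majorants :: "'a \<Rightarrow> 'a set" where
  "majorants x = {d\<in>D. star d = d \<and> pos (d - real_part x)}"

definition upper :: "('a \<Rightarrow> complex) \<Rightarrow> 'a \<Rightarrow> real" where
  "upper \<rho> x = (INF d\<in>majorants x. Re (\<rho> d))"

context
  fixes \<rho> assumes char: "character D \<rho>"
begin

lemma norm_majorant: "norm x *\<^sub>R 1 \<in> majorants x"
  using pos_of_norm_le[of "real_part x" "norm x"] norm_real_part_le[of x] by (simp add: majorants_def)

lemma upper_le: assumes "d \<in> majorants x" shows "upper \<rho> x \<le> Re (\<rho> d)"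
  unfolding upper_def
proof (rule cINF_lower[OF _ assms], rule bdd_belowI2)
  fix d assume d: "d \<in> majorants x"
  have "pos (norm x *\<^sub>R 1 - (- real_part x))"
    using pos_of_norm_le[of "- real_part x" "norm x"] norm_real_part_le[of x] by simp
  from pos_add[OF this, of "d - real_part x"] d have "pos (norm x *\<^sub>R 1 + d)"
    by (simp add: majorants_def)
  then show "- norm x \<le> Re (\<rho> d)"
    using pf_pos(2)[OF char_positive_functional[OF char]] d
    by (force simp: majorants_def char_simps[OF char])
qed

lemma upper_greatest: "(\<And>d. d \<in> majorants x \<Longrightarrow> c \<le> Re (\<rho> d)) \<Longrightarrow> c \<le> upper \<rho> x"
  unfolding upper_def by (rule cINF_greatest) (use norm_majorant in auto)

lemma upper_sublinear: "sublinear (upper \<rho>)"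
  unfolding sublinear_def
proof (intro conjI allI impI)
  fix x y
  have "upper \<rho> (x + y) - Re (\<rho> d) \<le> upper \<rho> y" if d: "d \<in> majorants x" for d
  proof (rule upper_greatest)
    fix d' assume d': "d' \<in> majorants y"
    have "d + d' \<in> majorants (x + y)"
      using pos_add[of "d - real_part x" "d' - real_part y"] d d' by (simp add: majorants_def algebra_simps)
    from upper_le[OF this] show "upper \<rho> (x + y) - Re (\<rho> d) \<le> Re (\<rho> d')"
      using d d' by (simp add: majorants_def char_simps[OF char])
  qed
  then have "upper \<rho> (x + y) - upper \<rho> y \<le> upper \<rho> x"
    by (intro upper_greatest) (simp add: algebra_simps)
  then show "upper \<rho> (x + y) \<le> upper \<rho> x + upper \<rho> y" by simp
next
  fix r :: real and x assume r: "r > 0"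
  have "upper \<rho> (r *\<^sub>R x) / r \<le> upper \<rho> x"
  proof (rule upper_greatest)
    fix d assume d: "d \<in> majorants x"
    have "r *\<^sub>R d \<in> majorants (r *\<^sub>R x)"
      using pos_scaleR[of "d - real_part x" r] d r by (simp add: majorants_def scaleR_right_diff_distrib)
    from upper_le[OF this] show "upper \<rho> (r *\<^sub>R x) / r \<le> Re (\<rho> d)"
      using d r by (simp add: majorants_def char_simps[OF char] field_simps)
  qed
  then show "upper \<rho> (r *\<^sub>R x) \<le> r * upper \<rho> x" using r by (simp add: field_simps)
qed

text \<open>
  A real-linear \<open>g\<close> below \<open>upper \<rho>\<close> is nonnegative on positive elements, since 0 is a majorant of
  their negatives, and agrees with the real part of \<open>\<rho>\<close> on \<open>D\<close>, since elements of \<open>D\<close> are controlled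
  by their own real parts. Its complexification is the state.
\<close>

lemma ex_state_extension:
  obtains s where "s \<in> states UNIV" "\<And>d. d \<in> D \<Longrightarrow> s d = \<rho> d" "Re (s y) = upper \<rho> y"
proof -
  obtain g where lin: "linear g" and gq: "\<And>x. g x \<le> upper \<rho> x" and gy: "g y = upper \<rho> y"
    using hahn_banach_sublinear[OF upper_sublinear, where y=y] by blast
  have neg: "g (- x) = - g x" for x using linear_neg[OF lin] .
  have g0: "g x \<le> 0" if "pos (- real_part x)" for x
    using gq[of x] upper_le[of 0 x] that by (simp add: majorants_def char_simps[OF char])
  have rneg: "real_part (- x) = - real_part x" for x :: 'a by (simp add: real_part_def algebra_simps)
  have gpos: "g x \<ge> 0" if "pos x" for x
    using g0[of "- x"] that by (simp add: rneg neg real_part_selfadjoint pos_star)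
  \<comment> \<open>\<open>\<i> *\<^sub>C x\<close> has real part 0, so 0 is a majorant of it and of its negative.\<close>
  have gim: "g (\<i> *\<^sub>C x) = 0" if "star x = x" for x
  proof -
    have "real_part (\<i> *\<^sub>C x) = 0"
      using that by (simp add: real_part_def star_scaleC complex_vector.scale_minus_left)
    then have "g (\<i> *\<^sub>C x) \<le> 0" "g (- (\<i> *\<^sub>C x)) \<le> 0" by (simp_all add: g0 rneg)
    then show ?thesis by (simp add: neg)
  qed
  have gD: "g d = Re (\<rho> d)" if d: "d \<in> D" for d
  proof -
    have le: "g d \<le> Re (\<rho> d)" if d: "d \<in> D" for d
    proof -
      have "real_part d \<in> majorants d" using d by (simp add: majorants_def real_part_def)
      from order_trans[OF gq upper_le[OF this]] show ?thesis
        using d by (simp add: real_part_def char_simps[OF char] char_star[OF char])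
    qed
    have "\<rho> (- d) = - \<rho> d" using char_simps(4)[OF char, of 0 d] char_simps(5)[OF char] d by simp
    then show ?thesis using le[OF d] le[of "- d"] d neg by simp
  qed
  \<comment> \<open>The complex-linear functional whose real part is \<open>g\<close>.\<close>
  define s where "s x = Complex (g x) (- g (\<i> *\<^sub>C x))" for x
  have add: "s (x + y) = s x + s y" for x y
    by (simp add: s_def complex_eq_iff linear_add[OF lin] scaleC_add_right)
  have sR: "g (r *\<^sub>R x) = r * g x" for r x using linear_scale[OF lin] by simp
  have sc: "s (c *\<^sub>C x) = c * s x" for c x
  proof -
    have 1: "c *\<^sub>C x = Re c *\<^sub>R x + Im c *\<^sub>R (\<i> *\<^sub>C x)"
      unfolding scaleR_scaleC scaleC_scaleC
      by (metis complex_eq complex_vector.scale_left_distrib mult.commute)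
    have 2: "\<i> *\<^sub>C (c *\<^sub>C x) = Re c *\<^sub>R (\<i> *\<^sub>C x) + Im c *\<^sub>R (- x)"
      unfolding 1 by (simp add: scaleC_add_right scaleC_scaleR_commute scaleC_scaleC complex_vector.scale_minus_left)
    show ?thesis unfolding s_def 2 unfolding 1
      by (simp add: complex_eq_iff linear_add[OF lin] sR linear_diff[OF lin])
  qed
  show thesis
  proof (rule that[of s])
    interpret U: unital_subalgebra "UNIV :: 'a set" by (rule unital_subalgebra_UNIV)
    have "positive_functional UNIV s"
      unfolding positive_functional_def complex_linear_on_def
    proof (intro conjI ballI allI)
      fix a :: 'a
      show "s (star a * a) \<in> \<real>\<^sub>\<ge>\<^sub>0"
        unfolding s_def complex_nonneg_Reals_iff
        using gpos[OF pos_star_mult_self] gim[of "star a * a"] by simp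
    qed (simp_all add: add sc)
    moreover have "s 1 = 1" using gD[of 1] gim[of 1] char_one[OF char] by (simp add: s_def complex_eq_iff)
    ultimately show "s \<in> states UNIV" by (simp add: U.states_iff)
    show "s d = \<rho> d" if "d \<in> D" for d
      using that gD by (simp add: s_def complex_eq_iff char_simps[OF char])
    show "Re (s y) = upper \<rho> y" by (simp add: s_def gy)
  qed
qed

end

end

locale extension_inclusion = abelian_unital_subalgebra D for D :: "'a::cstar_algebra_1 set" +
  assumes extension: "extension_property D"
begin

definition ext :: "('a \<Rightarrow> complex) \<Rightarrow> 'a \<Rightarrow> complex" where
  "ext \<rho> = (THE \<sigma>. \<sigma> \<in> states UNIV \<and> (\<forall>d\<in>D. \<sigma> d = \<rho> d))"

context
  fixes \<rho> assumes char: "character D \<rho>"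
begin

lemma ex1_ext: "\<exists>!\<sigma>. \<sigma> \<in> states UNIV \<and> (\<forall>d\<in>D. \<sigma> d = \<rho> d)"
  using extension char_pure_state[OF char] unfolding extension_property_def by fastforce

lemma ext_state: "ext \<rho> \<in> states UNIV" and ext_eq: "d \<in> D \<Longrightarrow> ext \<rho> d = \<rho> d"
  using theI'[OF ex1_ext] by (auto simp: ext_def)

text \<open>
  Uniqueness of the extension turns the existence of a state with the extreme value at \<open>y\<close> into a
  formula. The continuity of \<open>ext\<close> and excision both rest on it.
\<close>

lemma Re_ext: "Re (ext \<rho> y) = upper \<rho> y"
  using ex_state_extension[OF char, of y] ex1_ext ext_state ext_eq by metis

lemma ext_positive: "positive_functional UNIV (ext \<rho>)"
  using ext_state unital_subalgebra.states_iff[OF unital_subalgebra_UNIV] by blast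

lemma ext_linear: "complex_linear_on UNIV (ext \<rho>)"
  using ext_positive by (simp add: positive_functional_def)

lemma ext_majorant:
  assumes "\<epsilon> > 0" obtains d where "d \<in> majorants y" "Re (\<rho> d) < Re (ext \<rho> y) + \<epsilon>"
proof -
  have "\<not> (\<forall>d\<in>majorants y. upper \<rho> y + \<epsilon> \<le> Re (\<rho> d))"
    using upper_greatest[OF char, of y "upper \<rho> y + \<epsilon>"] assms by auto
  then show thesis using that Re_ext by force
qed

lemma ext_peak_compress:
  assumes "e \<in> peak D \<rho>" "f \<in> peak D \<rho>"
  shows "norm ((e * f) * x * (e * f) - c *\<^sub>C ((e * f) * (e * f))) \<le> norm (e * x * e - c *\<^sub>C (e * e))"
    and "norm ((e * f) * x * (e * f) - c *\<^sub>C ((e * f) * (e * f))) \<le> norm (f * x * f - c *\<^sub>C (f * f))"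
proof -
  have ef: "e * f = f * e" using commute assms peak_mem[OF char] by blast
  have "(e * f) * x * (e * f) - c *\<^sub>C ((e * f) * (e * f)) = f * (e * x * e - c *\<^sub>C (e * e)) * f"
    by (simp add: ef algebra_simps mult_scaleC_left mult_scaleC_right)
  moreover have "(e * f) * x * (e * f) - c *\<^sub>C ((e * f) * (e * f)) = e * (f * x * f - c *\<^sub>C (f * f)) * e"
    by (simp add: algebra_simps mult_scaleC_left mult_scaleC_right) (metis ef mult.assoc)
  ultimately show "norm ((e * f) * x * (e * f) - c *\<^sub>C ((e * f) * (e * f))) \<le> norm (e * x * e - c *\<^sub>C (e * e))"
    "norm ((e * f) * x * (e * f) - c *\<^sub>C ((e * f) * (e * f))) \<le> norm (f * x * f - c *\<^sub>C (f * f))"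
    using norm_peak_mult_le[OF char] norm_mult_peak_le[OF char] assms by (metis order_trans)+
qed

text \<open>
  By \<open>Re_ext\<close> there are \<open>d\<close> and \<open>d'\<close> in \<open>D\<close> with \<open>- d' \<le> y \<le> d\<close> whose values under \<open>\<rho>\<close> are close to
  those of \<open>y\<close> and \<open>- y\<close> under \<open>ext \<rho>\<close>. Compressing by a peak \<open>e\<close> on which \<open>d\<close> and \<open>d'\<close> are nearly
  scalar squeezes \<open>e * y * e\<close> between two multiples of \<open>e * e\<close> that nearly coincide.
\<close>

lemma excision_selfadjoint:
  assumes y: "star y = y" and \<epsilon>: "\<epsilon> > 0"
  obtains e where "e \<in> peak D \<rho>" "norm (e * y * e - ext \<rho> y *\<^sub>C (e * e)) < \<epsilon>"
proof -
  interpret U: unital_subalgebra "UNIV :: 'a set" by (rule unital_subalgebra_UNIV)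
  define \<delta> where "\<delta> = \<epsilon> / 5"
  have \<delta>: "\<delta> > 0" using \<epsilon> by (simp add: \<delta>_def)
  have key: "pos ((3 * \<delta>) *\<^sub>R 1 - (e * y * e - r *\<^sub>R (e * e)))"
    if e: "e \<in> peak D \<rho>" and d: "d \<in> D" "star d = d" "pos (d - y)" "Re (\<rho> d) < r + \<delta>"
      and n: "norm (d * e - \<rho> d *\<^sub>C e) < \<delta>" for e d y r
  proof -
    have rd: "\<rho> d = of_real (Re (\<rho> d))"
      using char_selfadjoint_real[OF char d(1,2)] by (simp add: complex_eq_iff)
    have es: "star e = e" "norm e \<le> 1" using e by (auto simp: peak_def)
    define z where "z = e * d * e - Re (\<rho> d) *\<^sub>R (e * e)"
    have "z = e * (d * e - \<rho> d *\<^sub>C e)"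
      by (subst rd) (simp add: z_def algebra_simps scaleC_of_real)
    then have "norm z \<le> \<delta>"
      using norm_peak_mult_le[OF char e, of "d * e - \<rho> d *\<^sub>C e"] n by simp
    moreover have "star z = z" using es d by (simp add: z_def mult.assoc)
    ultimately have 1: "pos (\<delta> *\<^sub>R 1 - z)" by (intro pos_of_norm_le)
    have 2: "pos (e * (d - y) * e)" using pos_conjugate[OF d(3), of e] es by simp
    have pe: "pos (e * e)" using pos_square[OF es(1)] .
    have 3: "pos ((r + \<delta> - Re (\<rho> d)) *\<^sub>R (e * e))" using pos_scaleR[OF pe] d(4) by simp
    have "norm (e * e) \<le> 1" using norm_peak_mult_le[OF char e, of e] es by simp
    then have "pos (1 *\<^sub>R 1 - e * e)" by (intro pos_of_norm_le) (simp add: es)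
    then have 4: "pos (\<delta> *\<^sub>R (1 - e * e))" using \<delta> by (intro pos_scaleR) auto
    have "pos (e * (d - y) * e + (\<delta> *\<^sub>R 1 - z) + (r + \<delta> - Re (\<rho> d)) *\<^sub>R (e * e) + \<delta> *\<^sub>R (1 - e * e) + \<delta> *\<^sub>R 1)"
      by (intro pos_add 1 2 3 4 pos_scaleR) (use \<delta> in auto)
    also have "e * (d - y) * e + (\<delta> *\<^sub>R 1 - z) + (r + \<delta> - Re (\<rho> d)) *\<^sub>R (e * e) + \<delta> *\<^sub>R (1 - e * e) + \<delta> *\<^sub>R 1
      = (3 * \<delta>) *\<^sub>R 1 - (e * y * e - r *\<^sub>R (e * e))"
    proof -
      have three: "(3 * \<delta>) *\<^sub>R (1::'a) = \<delta> *\<^sub>R 1 + \<delta> *\<^sub>R 1 + \<delta> *\<^sub>R 1"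
        by (simp flip: scaleR_add_left)
      show ?thesis unfolding three by (simp add: z_def algebra_simps)
    qed
    finally show ?thesis .
  qed
  define r where "r = Re (ext \<rho> y)"
  have er: "ext \<rho> y = of_real r"
    using U.pf_hermitian[OF ext_positive, of y] y by (simp add: r_def complex_eq_iff)
  obtain d where d: "d \<in> majorants y" "Re (\<rho> d) < r + \<delta>" using ext_majorant[OF \<delta>, of y] r_def by blast
  obtain d' where d': "d' \<in> majorants (- y)" "Re (\<rho> d') < - r + \<delta>"
    using ext_majorant[OF \<delta>, of "- y"] complex_linear_on_diff[OF ext_linear U.csub, of 0 y]
      complex_linear_on_zero[OF ext_linear U.csub] r_def by auto
  have dD: "d \<in> D" "star d = d" "pos (d - y)" "d' \<in> D" "star d' = d'" "pos (d' - (- y))"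
    using d d' y by (auto simp: majorants_def real_part_selfadjoint)
  obtain e1 where e1: "e1 \<in> peak D \<rho>" "norm (d * e1 - \<rho> d *\<^sub>C e1) < \<delta>"
    using ex_peak_eigen[OF char dD(1) \<delta>] by blast
  obtain e2 where e2: "e2 \<in> peak D \<rho>" "norm (d' * e2 - \<rho> d' *\<^sub>C e2) < \<delta>"
    using ex_peak_eigen[OF char dD(4) \<delta>] by blast
  define e where "e = e1 * e2"
  have e: "e \<in> peak D \<rho>" unfolding e_def by (rule peak_mult[OF char e1(1) e2(1)])
  have com: "e1 * e2 = e2 * e1" using commute e1 e2 peak_mem[OF char] by blast
  have "d * e - \<rho> d *\<^sub>C e = (d * e1 - \<rho> d *\<^sub>C e1) * e2"
    by (simp add: e_def algebra_simps mult_scaleC_left)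
  then have n1: "norm (d * e - \<rho> d *\<^sub>C e) < \<delta>"
    using norm_mult_peak_le[OF char e2(1)] e1(2) by (metis order_le_less_trans)
  have "d' * e - \<rho> d' *\<^sub>C e = (d' * e2 - \<rho> d' *\<^sub>C e2) * e1"
    by (simp add: e_def com algebra_simps mult_scaleC_left)
  then have n2: "norm (d' * e - \<rho> d' *\<^sub>C e) < \<delta>"
    using norm_mult_peak_le[OF char e1(1)] e2(2) by (metis order_le_less_trans)
  have "norm (e * y * e - r *\<^sub>R (e * e)) \<le> 3 * \<delta>"
  proof (rule norm_le_of_sandwich)
    show "pos ((3 * \<delta>) *\<^sub>R 1 - (e * y * e - r *\<^sub>R (e * e)))"
      by (rule key[OF e dD(1-3) d(2) n1])
    show "pos ((3 * \<delta>) *\<^sub>R 1 + (e * y * e - r *\<^sub>R (e * e)))"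
      using key[OF e dD(4-6) d'(2) n2] by (simp add: algebra_simps)
  qed (use \<delta> in simp)
  also have "\<dots> < \<epsilon>" using \<epsilon> by (simp add: \<delta>_def)
  finally show thesis using that[OF e] er by (simp add: scaleC_of_real)
qed

lemma cartesian_decomposition:
  fixes x :: 'a
  shows "x = real_part x + \<i> *\<^sub>C real_part (- \<i> *\<^sub>C x)"
  by (simp add: real_part_def star_scaleC scaleC_scaleR_commute scaleC_add_right scaleC_scaleC scaleC_diff_right
    complex_vector.scale_minus_left algebra_simps flip: scaleR_2)

lemma excision:
  assumes \<epsilon>: "\<epsilon> > 0"
  obtains e where "e \<in> peak D \<rho>" "norm (e * x * e - ext \<rho> x *\<^sub>C (e * e)) < \<epsilon>"
proof -
  define a b where "a = real_part x" and "b = real_part (- \<i> *\<^sub>C x)"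
  have x: "x = a + \<i> *\<^sub>C b" unfolding a_def b_def by (rule cartesian_decomposition)
  obtain e where e: "e \<in> peak D \<rho>" "norm (e * a * e - ext \<rho> a *\<^sub>C (e * e)) < \<epsilon> / 2"
    using excision_selfadjoint[of a "\<epsilon>/2"] \<epsilon> by (auto simp: a_def)
  obtain f where f: "f \<in> peak D \<rho>" "norm (f * b * f - ext \<rho> b *\<^sub>C (f * f)) < \<epsilon> / 2"
    using excision_selfadjoint[of b "\<epsilon>/2"] \<epsilon> by (auto simp: b_def)
  define g where "g = e * f"
  have "g * x * g - ext \<rho> x *\<^sub>C (g * g) = (g * a * g - ext \<rho> a *\<^sub>C (g * g)) + \<i> *\<^sub>C (g * b * g - ext \<rho> b *\<^sub>C (g * g))"
    by (simp add: x complex_linear_on_add[OF ext_linear] complex_linear_on_scaleC[OF ext_linear]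
      algebra_simps mult_scaleC_left mult_scaleC_right scaleC_diff_right scaleC_add_left scaleC_scaleC)
  also have "norm \<dots> \<le> norm (g * a * g - ext \<rho> a *\<^sub>C (g * g)) + norm (g * b * g - ext \<rho> b *\<^sub>C (g * g))"
    by (rule order_trans[OF norm_triangle_ineq]) (simp add: norm_scaleC)
  also have "\<dots> < \<epsilon>"
    using ext_peak_compress[OF e(1) f(1), of a "ext \<rho> a"] ext_peak_compress[OF e(1) f(1), of b "ext \<rho> b"] e f
    unfolding g_def by linarith
  finally show thesis using that peak_mult[OF char e(1) f(1)] by (simp add: g_def)
qed

end

end

section \<open>Eigenfunctionals\<close>

lemma dual_norm_bound:
  assumes M: "csubspace M" and \<phi>: "\<phi> \<in> cdual M" and m: "m \<in> M"
  shows "norm (\<phi> m) \<le> dual_norm M \<phi> * norm m"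
proof (cases "m = 0")
  case True
  have "\<phi> 0 = 0"
    by (rule complex_linear_on_zero[OF _ M]) (use \<phi> in \<open>simp add: cdual_def complex_linear_on_def\<close>)
  then show ?thesis using True by simp
next
  case False
  obtain K where K: "\<And>x. x \<in> M \<Longrightarrow> norm (\<phi> x) \<le> K * norm x" using \<phi> unfolding cdual_def by blast
  define x where "x = complex_of_real (1 / norm m) *\<^sub>C m"
  have x: "x \<in> M" "norm x = 1" using m M False by (auto simp: x_def complex_vector.subspace_scale norm_scaleC norm_divide)
  have "bdd_above ((\<lambda>x. norm (\<phi> x)) ` {x\<in>M. norm x \<le> 1})"
  proof (rule bdd_aboveI2)
    fix y assume y: "y \<in> {x\<in>M. norm x \<le> 1}"
    then have "norm (\<phi> y) \<le> K * norm y" using K by simp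
    also have "\<dots> \<le> \<bar>K\<bar> * 1" using y by (intro mult_mono) auto
    finally show "norm (\<phi> y) \<le> \<bar>K\<bar>" by simp
  qed
  then have "norm (\<phi> x) \<le> dual_norm M \<phi>"
    unfolding dual_norm_def by (rule cSUP_upper[rotated]) (use x in simp)
  moreover have "\<phi> x = complex_of_real (1 / norm m) * \<phi> m" using \<phi> m by (simp add: x_def cdual_def)
  ultimately show ?thesis using False by (simp add: norm_mult norm_divide field_simps)
qed

lemma dual_norm_le:
  assumes M: "csubspace M" and c: "c \<ge> 0" and le: "\<And>m. m \<in> M \<Longrightarrow> norm (\<phi> m) \<le> c * norm m"
  shows "dual_norm M \<phi> \<le> c"
  unfolding dual_norm_def
proof (rule cSUP_least)
  show "{x \<in> M. norm x \<le> 1} \<noteq> {}" using complex_vector.subspace_0[OF M] by force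
  fix x assume x: "x \<in> {x \<in> M. norm x \<le> 1}"
  then have "norm (\<phi> x) \<le> c * norm x" using le by simp
  also have "\<dots> \<le> c * 1" using x c by (intro mult_left_mono) auto
  finally show "norm (\<phi> x) \<le> c" by simp
qed

definition eigenfunctional ::
  "'a::cstar_algebra_1 set \<Rightarrow> 'a set \<Rightarrow> ('a \<Rightarrow> complex) \<Rightarrow> ('a \<Rightarrow> complex) \<Rightarrow> ('a \<Rightarrow> complex) \<Rightarrow> bool" where
  "eigenfunctional D M \<sigma> \<rho> \<phi> \<longleftrightarrow> \<phi> \<in> cdual M \<and> (\<forall>d\<in>D. \<forall>m\<in>M. \<phi> (d * m) = \<sigma> d * \<phi> m \<and> \<phi> (m * d) = \<rho> d * \<phi> m)"

text \<open>
  The eigenvalues of \<open>\<phi>\<close>, read off at one element \<open>m\<close> with \<open>\<phi> m \<noteq> 0\<close>. The explicit quotient makes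
  their continuity in \<open>\<phi>\<close> immediate.
\<close>

definition range_char :: "'a::cstar_algebra_1 \<Rightarrow> ('a \<Rightarrow> complex) \<Rightarrow> 'a \<Rightarrow> complex" where
  "range_char m \<phi> d = \<phi> (d * m) / \<phi> m"

definition source_char :: "'a::cstar_algebra_1 \<Rightarrow> ('a \<Rightarrow> complex) \<Rightarrow> 'a \<Rightarrow> complex" where
  "source_char m \<phi> d = \<phi> (m * d) / \<phi> m"

context abelian_unital_subalgebra
begin

lemma bimodule_mult:
  assumes "bimodule D M" "m \<in> M" "d \<in> D" shows "d * m \<in> M" "m * d \<in> M"
proof -
  have "d * m * 1 \<in> M" "1 * m * d \<in> M" using assms one unfolding bimodule_def by blast+
  then show "d * m \<in> M" "m * d \<in> M" by simp_all
qed

lemma bimodule_csubspace: "bimodule D M \<Longrightarrow> csubspace M" by (simp add: bimodule_def)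

text \<open>
  Contractivity of the eigenvalues holds because multiplication by \<open>d\<close> multiplies the norm of \<open>\<phi>\<close> by
  the modulus of the eigenvalue, but increases norms of arguments at most by the factor \<open>norm d\<close>.
\<close>

lemma eigenfunctional_characters:
  assumes M: "bimodule D M" and \<phi>: "\<phi> \<in> cdual M" and m0: "m0 \<in> M" "\<phi> m0 \<noteq> 0"
    and L: "\<And>d. d \<in> D \<Longrightarrow> \<exists>c. \<forall>m\<in>M. \<phi> (d * m) = c * \<phi> m"
    and R: "\<And>d. d \<in> D \<Longrightarrow> \<exists>c. \<forall>m\<in>M. \<phi> (m * d) = c * \<phi> m"
  shows "eigenfunctional D M (range_char m0 \<phi>) (source_char m0 \<phi>) \<phi>"
    and "character D (range_char m0 \<phi>)" and "character D (source_char m0 \<phi>)"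
proof -
  note cs = bimodule_csubspace[OF M]
  have lin: "complex_linear_on M \<phi>" using \<phi> by (simp add: cdual_def complex_linear_on_def)
  have l: "\<phi> (d * m) = range_char m0 \<phi> d * \<phi> m" if "d \<in> D" "m \<in> M" for d m
    using L[OF that(1)] that m0 unfolding range_char_def by fastforce
  have r: "\<phi> (m * d) = source_char m0 \<phi> d * \<phi> m" if "d \<in> D" "m \<in> M" for d m
    using R[OF that(1)] that m0 unfolding source_char_def by fastforce
  show "eigenfunctional D M (range_char m0 \<phi>) (source_char m0 \<phi>) \<phi>"
    using \<phi> l r by (simp add: eigenfunctional_def)
  have bound: "norm c \<le> norm d"
    if c: "\<And>m. m \<in> M \<Longrightarrow> \<exists>m'\<in>M. \<phi> m' = c * \<phi> m \<and> norm m' \<le> norm d * norm m" for c and d :: 'a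
  proof (cases "c = 0")
    case False
    let ?N = "dual_norm M \<phi>"
    have "0 < norm (\<phi> m0)" using m0 by simp
    also have "\<dots> \<le> ?N * norm m0" by (rule dual_norm_bound[OF cs \<phi> m0(1)])
    finally have N: "?N > 0" by (simp add: zero_less_mult_iff)
    have "?N \<le> ?N * norm d / norm c"
    proof (rule dual_norm_le[OF cs])
      fix m assume "m \<in> M"
      then obtain m' where m': "m' \<in> M" "\<phi> m' = c * \<phi> m" "norm m' \<le> norm d * norm m" using c by blast
      have "norm c * norm (\<phi> m) = norm (\<phi> m')" by (simp add: m' norm_mult)
      also have "\<dots> \<le> ?N * norm m'" by (rule dual_norm_bound[OF cs \<phi> m'(1)])
      also have "\<dots> \<le> ?N * (norm d * norm m)" using m' N by simp
      finally show "norm (\<phi> m) \<le> ?N * norm d / norm c * norm m" using False by (simp add: field_simps)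
    qed (use N in simp)
    then show ?thesis using N False by (simp add: field_simps)
  qed simp
  note simps = complex_linear_on_add[OF lin] complex_linear_on_scaleC[OF lin] bimodule_mult[OF M]
  show "character D (range_char m0 \<phi>)"
    unfolding character_def complex_linear_on_def
  proof (intro conjI ballI allI)
    fix x y assume "x \<in> D" "y \<in> D"
    then show "range_char m0 \<phi> (x + y) = range_char m0 \<phi> x + range_char m0 \<phi> y"
      using m0 by (simp add: range_char_def distrib_right simps add_divide_distrib)
    show "range_char m0 \<phi> (x * y) = range_char m0 \<phi> x * range_char m0 \<phi> y"
      using l[of x "y * m0"] \<open>x \<in> D\<close> \<open>y \<in> D\<close> m0 by (simp add: range_char_def simps mult.assoc)
  next
    fix c x assume "x \<in> D"
    then show "range_char m0 \<phi> (c *\<^sub>C x) = c * range_char m0 \<phi> x"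
      using m0 by (simp add: range_char_def mult_scaleC_left simps)
  next
    fix d assume d: "d \<in> D"
    show "norm (range_char m0 \<phi> d) \<le> norm d"
      by (rule bound) (metis d l bimodule_mult[OF M] norm_mult_ineq)
  qed (use m0 in \<open>simp add: range_char_def\<close>)
  show "character D (source_char m0 \<phi>)"
    unfolding character_def complex_linear_on_def
  proof (intro conjI ballI allI)
    fix x y assume "x \<in> D" "y \<in> D"
    then show "source_char m0 \<phi> (x + y) = source_char m0 \<phi> x + source_char m0 \<phi> y"
      using m0 by (simp add: source_char_def distrib_left simps add_divide_distrib)
    show "source_char m0 \<phi> (x * y) = source_char m0 \<phi> x * source_char m0 \<phi> y"
      using r[of y "m0 * x"] \<open>x \<in> D\<close> \<open>y \<in> D\<close> m0 by (simp add: source_char_def simps mult.assoc[symmetric])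
  next
    fix c x assume "x \<in> D"
    then show "source_char m0 \<phi> (c *\<^sub>C x) = c * source_char m0 \<phi> x"
      using m0 by (simp add: source_char_def mult_scaleC_right simps)
  next
    fix d assume d: "d \<in> D"
    show "norm (source_char m0 \<phi> d) \<le> norm d"
      by (rule bound) (metis d r bimodule_mult[OF M] norm_mult_ineq mult.commute)
  qed (use m0 in \<open>simp add: source_char_def\<close>)
qed

lemma normalizer_mem:
  assumes "v \<in> normalizers D" shows "d \<in> D \<Longrightarrow> v * d * star v \<in> D" "star v * v \<in> D"
  using assms one unfolding normalizers_def by (auto dest: bspec[where x=1])

lemma normalizer_scaleC: assumes "v \<in> normalizers D" shows "c *\<^sub>C v \<in> normalizers D"
  using assms by (simp add: normalizers_def star_scaleC mult_scaleC_left mult_scaleC_right)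

text \<open>
  When \<open>\<rho> (star v * v) \<noteq> 0\<close> this says that \<open>\<sigma>\<close> is the image of \<open>\<rho>\<close> under the partial homeomorphism of
  the spectrum of \<open>D\<close> induced by the normalizer \<open>v\<close>.
\<close>

definition linked :: "'a \<Rightarrow> ('a \<Rightarrow> complex) \<Rightarrow> ('a \<Rightarrow> complex) \<Rightarrow> bool" where
  "linked v \<sigma> \<rho> \<longleftrightarrow> (\<forall>d\<in>D. \<sigma> (v * d * star v) = \<rho> d * \<rho> (star v * v))"

text \<open>
  The element \<open>v * d * star v * v\<close> can be evaluated near \<open>\<sigma>\<close> from the left and near \<open>\<rho>\<close> from the
  right; both ways give a scalar multiple of \<open>e * v * f\<close>, which is bounded away from 0.
\<close>

lemma normalizer_linked:
  assumes v: "v \<in> normalizers D" and \<sigma>: "character D \<sigma>" and \<rho>: "character D \<rho>" and c: "c > 0"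
    and ge: "\<And>e f. e \<in> peak D \<sigma> \<Longrightarrow> f \<in> peak D \<rho> \<Longrightarrow> c \<le> norm (e * v * f)"
  shows "c\<^sup>2 \<le> Re (\<rho> (star v * v))" and "linked v \<sigma> \<rho>"
proof -
  note vD = normalizer_mem[OF v]
  have real: "\<rho> (star v * v) = of_real (Re (\<rho> (star v * v)))" "Re (\<rho> (star v * v)) \<ge> 0"
    using pf_pos[OF char_positive_functional[OF \<rho>] pos_star_mult_self vD(2)] by (auto simp: complex_eq_iff)
  show "c\<^sup>2 \<le> Re (\<rho> (star v * v))"
  proof (rule field_le_epsilon)
    fix \<epsilon> :: real assume \<epsilon>: "\<epsilon> > 0"
    obtain f where f: "f \<in> peak D \<rho>" "norm (star v * v * f - \<rho> (star v * v) *\<^sub>C f) < \<epsilon>"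
      using ex_peak_eigen[OF \<rho> vD(2) \<epsilon>] by blast
    have "c \<le> norm (v * f)" using ge[OF peak_one[OF \<sigma>] f(1)] by simp
    then have "c\<^sup>2 \<le> (norm (v * f))\<^sup>2" using c by (simp add: power_mono)
    also have "\<dots> = norm (star (v * f) * (v * f))" by (rule cstar_identity[symmetric])
    also have "star (v * f) * (v * f) = f * (star v * v * f)"
      using peak_star[OF \<rho> f(1)] by (simp add: mult.assoc)
    also have "norm \<dots> \<le> norm (star v * v * f)" by (rule norm_peak_mult_le[OF \<rho> f(1)])
    also have "\<dots> \<le> norm (star v * v * f - \<rho> (star v * v) *\<^sub>C f) + norm (\<rho> (star v * v) *\<^sub>C f)"
      by (metis diff_add_cancel norm_triangle_ineq)
    also have "norm (\<rho> (star v * v) *\<^sub>C f) \<le> norm (\<rho> (star v * v))"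
      using peak_norm[OF \<rho> f(1)] by (simp add: norm_scaleC mult_left_le)
    also have "norm (\<rho> (star v * v)) = Re (\<rho> (star v * v))" using real by (metis norm_of_real abs_of_nonneg)
    finally show "c\<^sup>2 \<le> Re (\<rho> (star v * v)) + \<epsilon>" using f(2) by simp
  qed
  show "linked v \<sigma> \<rho>"
    unfolding linked_def
  proof
    fix d assume d: "d \<in> D"
    define k where "k = v * d * star v"
    define l where "l = d * (star v * v)"
    have kl: "k \<in> D" "l \<in> D" using d vD by (auto simp: k_def l_def)
    have kv: "k * v = v * l" by (simp add: k_def l_def mult.assoc)
    have small: "norm (\<sigma> k - \<rho> l) * c \<le> 2 * \<epsilon> * norm v" if \<epsilon>: "\<epsilon> > 0" for \<epsilon>
    proof -
      obtain e where e: "e \<in> peak D \<sigma>" "norm (k * e - \<sigma> k *\<^sub>C e) < \<epsilon>"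
        using ex_peak_eigen[OF \<sigma> kl(1) \<epsilon>] by blast
      obtain f where f: "f \<in> peak D \<rho>" "norm (l * f - \<rho> l *\<^sub>C f) < \<epsilon>"
        using ex_peak_eigen[OF \<rho> kl(2) \<epsilon>] by blast
      have ke: "k * e = e * k" using commute[OF kl(1) peak_mem[OF \<sigma> e(1)]] .
      have "(\<sigma> k - \<rho> l) *\<^sub>C (e * v * f) = e * v * (l * f - \<rho> l *\<^sub>C f) - (k * e - \<sigma> k *\<^sub>C e) * v * f"
      proof -
        have "e * v * (l * f) = k * e * v * f" by (simp add: ke) (metis kv mult.assoc)
        then show ?thesis
          by (simp add: left_diff_distrib right_diff_distrib mult_scaleC_left mult_scaleC_right
            complex_vector.scale_left_diff_distrib)
      qed
      then have "norm (\<sigma> k - \<rho> l) * norm (e * v * f)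
          = norm (e * v * (l * f - \<rho> l *\<^sub>C f) - (k * e - \<sigma> k *\<^sub>C e) * v * f)"
        by (metis norm_scaleC)
      also have "\<dots> \<le> norm (e * v * (l * f - \<rho> l *\<^sub>C f)) + norm ((k * e - \<sigma> k *\<^sub>C e) * v * f)"
        by (rule norm_triangle_ineq4)
      also have "norm (e * v * (l * f - \<rho> l *\<^sub>C f)) \<le> norm v * \<epsilon>"
        using norm_peak_mult_le[OF \<sigma> e(1), of v] f(2)
        by (intro order_trans[OF norm_mult_ineq[of "e * v"] mult_mono]) auto
      also have "norm ((k * e - \<sigma> k *\<^sub>C e) * v * f) \<le> \<epsilon> * norm v"
        using norm_mult_peak_le[OF \<rho> f(1), of v] e(2) \<epsilon> unfolding mult.assoc[of _ v f]
        by (intro order_trans[OF norm_mult_ineq[of _ "v * f"] mult_mono]) auto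
      finally have "norm (\<sigma> k - \<rho> l) * norm (e * v * f) \<le> 2 * \<epsilon> * norm v" by simp
      moreover have "norm (\<sigma> k - \<rho> l) * c \<le> norm (\<sigma> k - \<rho> l) * norm (e * v * f)"
        using ge[OF e(1) f(1)] by (simp add: mult_left_mono)
      ultimately show ?thesis by linarith
    qed
    have "norm (\<sigma> k - \<rho> l) * c \<le> 0"
    proof (rule field_le_epsilon)
      fix \<eta> :: real assume \<eta>: "\<eta> > 0"
      define \<epsilon> where "\<epsilon> = \<eta> / (2 * (norm v + 1))"
      have p: "norm v + 1 > 0" by (simp add: add_nonneg_pos)
      then have \<epsilon>: "\<epsilon> > 0" using \<eta> by (simp add: \<epsilon>_def)
      have "2 * \<epsilon> * norm v \<le> 2 * \<epsilon> * (norm v + 1)" using \<epsilon> by (intro mult_left_mono) auto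
      also have "\<dots> = \<eta>" using p unfolding \<epsilon>_def by (simp add: field_simps)
      finally show "norm (\<sigma> k - \<rho> l) * c \<le> 0 + \<eta>" using small[OF \<epsilon>] by simp
    qed
    then have "\<sigma> k = \<rho> l" using c by (simp add: mult_le_0_iff)
    then show "\<sigma> (v * d * star v) = \<rho> d * \<rho> (star v * v)"
      using char_mult[OF \<rho> d vD(2)] by (simp add: k_def l_def)
  qed
qed

text \<open>
  If each summand can be made small by some pair of peaks, the products of these peaks make all
  summands small at once.
\<close>

lemma ex_peaks_sum:
  fixes c :: real
  assumes \<sigma>: "character D \<sigma>" and \<rho>: "character D \<rho>" and I: "finite I"
    and "\<And>a. a \<in> I \<Longrightarrow> \<exists>e\<in>peak D \<sigma>. \<exists>f\<in>peak D \<rho>. norm (e * g a * f) < c"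
  shows "\<exists>e\<in>peak D \<sigma>. \<exists>f\<in>peak D \<rho>. norm (e * (\<Sum>a\<in>I. g a) * f) \<le> card I * c"
  using I assms(4)
proof (induction I)
  case empty
  then show ?case using peak_one[OF \<sigma>] peak_one[OF \<rho>] by force
next
  case (insert a I)
  obtain e f where ef: "e \<in> peak D \<sigma>" "f \<in> peak D \<rho>" "norm (e * (\<Sum>a\<in>I. g a) * f) \<le> card I * c"
    using insert by auto
  obtain e' f' where ef': "e' \<in> peak D \<sigma>" "f' \<in> peak D \<rho>" "norm (e' * g a * f') < c"
    using insert.prems[of a] by blast
  have com: "e * e' = e' * e" using commute ef ef' peak_mem[OF \<sigma>] by blast
  have comf: "f * f' = f' * f" using commute ef ef' peak_mem[OF \<rho>] by blast
  let ?s = "\<Sum>a\<in>I. g a"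
  have "e * e' * (\<Sum>a\<in>insert a I. g a) * (f * f') = e * (e' * g a * f') * f + e' * (e * ?s * f) * f'"
  proof -
    have "e * e' * (\<Sum>a\<in>insert a I. g a) * (f * f') = e * e' * g a * (f * f') + e * e' * ?s * (f * f')"
      using insert by (simp add: distrib_left distrib_right)
    also have "e * e' * g a * (f * f') = e * (e' * g a * f') * f" unfolding comf by (simp add: mult.assoc)
    also have "e * e' * ?s * (f * f') = e' * (e * ?s * f) * f'" unfolding com by (simp add: mult.assoc)
    finally show ?thesis .
  qed
  also have "norm \<dots> \<le> norm (e * (e' * g a * f') * f) + norm (e' * (e * ?s * f) * f')"
    by (rule norm_triangle_ineq)
  also have "norm (e * (e' * g a * f') * f) \<le> norm (e' * g a * f')"
    by (rule order_trans[OF norm_mult_peak_le[OF \<rho> ef(2)] norm_peak_mult_le[OF \<sigma> ef(1)]])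
  also have "norm (e' * (e * ?s * f) * f') \<le> norm (e * ?s * f)"
    by (rule order_trans[OF norm_mult_peak_le[OF \<rho> ef'(2)] norm_peak_mult_le[OF \<sigma> ef'(1)]])
  finally have "norm (e * e' * (\<Sum>a\<in>insert a I. g a) * (f * f')) \<le> card (insert a I) * c"
    using ef(3) ef'(3) insert by (simp add: algebra_simps)
  then show ?case using peak_mult[OF \<sigma> ef(1) ef'(1)] peak_mult[OF \<rho> ef(2) ef'(2)] by blast
qed

end

context extension_inclusion
begin

text \<open>
  For a peak \<open>e\<close> put \<open>w = v * (e * e) * star v\<close>. Then \<open>\<phi> (w * m * e)\<close> is \<open>\<rho> (star v * v) * \<phi> m\<close>
  because \<open>v\<close> links \<open>\<rho>\<close> to \<open>\<sigma>\<close>, while excision of \<open>star v * m\<close> bounds the norm of \<open>w * m * e\<close> by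
  about \<open>norm (ext \<rho> (star v * m)) * sqrt (Re (\<rho> (star v * v)))\<close>.
\<close>

lemma eigenfunctional_upper:
  assumes M: "bimodule D M" and \<sigma>: "character D \<sigma>" and \<rho>: "character D \<rho>"
    and \<phi>: "eigenfunctional D M \<sigma> \<rho> \<phi>" and v: "v \<in> normalizers D" "linked v \<sigma> \<rho>"
    and r: "Re (\<rho> (star v * v)) > 0" and m: "m \<in> M"
  shows "norm (\<phi> m) * sqrt (Re (\<rho> (star v * v))) \<le> dual_norm M \<phi> * norm (ext \<rho> (star v * m))"
proof -
  note vD = normalizer_mem[OF v(1)] and cs = bimodule_csubspace[OF M]
  define r where "r = Re (\<rho> (star v * v))"
  have r0: "r > 0" using r by (simp add: r_def)
  have real: "\<rho> (star v * v) = of_real r"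
    using pf_pos[OF char_positive_functional[OF \<rho>] pos_star_mult_self vD(2)] by (simp add: complex_eq_iff r_def)
  have cd: "\<phi> \<in> cdual M" using \<phi> by (simp add: eigenfunctional_def)
  define N where "N = dual_norm M \<phi>"
  have N: "norm (\<phi> x) \<le> N * norm x" if "x \<in> M" for x
    using dual_norm_bound[OF cs cd that] by (simp add: N_def)
  have N0: "N \<ge> 0 \<or> (\<forall>x\<in>M. norm x = 0)"
    using N by (meson mult_less_0_iff norm_ge_zero not_less order_trans order_le_less zero_less_norm_iff not_le)
  define p where "p = ext \<rho> (star v * m)"
  show ?thesis
  proof (cases "m = 0")
    case True
    have "\<phi> 0 = 0" using cd by (intro complex_linear_on_zero[OF _ cs]) (simp add: cdual_def complex_linear_on_def)
    moreover have "ext \<rho> 0 = 0"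
      by (rule complex_linear_on_zero[OF ext_linear[OF \<rho>]]) (rule complex_vector.subspace_UNIV)
    ultimately show ?thesis using True by simp
  next
    case False
    then have N0: "N \<ge> 0" using N0 m by auto
    have key: "r * norm (\<phi> m) \<le> N * (norm v * \<epsilon> + norm p * sqrt (r + \<epsilon>))" if \<epsilon>: "\<epsilon> > 0" for \<epsilon>
    proof -
      obtain e1 where e1: "e1 \<in> peak D \<rho>" "norm (e1 * (star v * m) * e1 - p *\<^sub>C (e1 * e1)) < \<epsilon>"
        using excision[OF \<rho> \<epsilon>] unfolding p_def by blast
      obtain e2 where e2: "e2 \<in> peak D \<rho>" "norm (star v * v * e2 - \<rho> (star v * v) *\<^sub>C e2) < \<epsilon>"
        using ex_peak_eigen[OF \<rho> vD(2) \<epsilon>] by blast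
      define e where "e = e1 * e2"
      have e: "e \<in> peak D \<rho>" unfolding e_def by (rule peak_mult[OF \<rho> e1(1) e2(1)])
      have com: "e = e2 * e1" using commute e1 e2 peak_mem[OF \<rho>] unfolding e_def by blast
      have n1: "norm (e * (star v * m) * e - p *\<^sub>C (e * e)) \<le> \<epsilon>"
        using ext_peak_compress(1)[OF \<rho> e1(1) e2(1), of "star v * m" p] e1(2) unfolding e_def by linarith
      have "star v * v * e - \<rho> (star v * v) *\<^sub>C e = (star v * v * e2 - \<rho> (star v * v) *\<^sub>C e2) * e1"
        by (simp add: com left_diff_distrib mult_scaleC_left mult.assoc)
      then have n2: "norm (star v * v * e - \<rho> (star v * v) *\<^sub>C e) \<le> \<epsilon>"
        using norm_mult_peak_le[OF \<rho> e1(1)] e2(2) by (metis order.trans order_less_imp_le)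
      have "(norm (v * e))\<^sup>2 = norm (star (v * e) * (v * e))" by (rule cstar_identity[symmetric])
      also have "star (v * e) * (v * e) = e * (star v * v * e)"
        using peak_star[OF \<rho> e] by (simp add: mult.assoc)
      also have "norm \<dots> \<le> norm (star v * v * e)" by (rule norm_peak_mult_le[OF \<rho> e])
      also have "\<dots> \<le> norm (star v * v * e - \<rho> (star v * v) *\<^sub>C e) + norm (\<rho> (star v * v) *\<^sub>C e)"
        by (metis diff_add_cancel norm_triangle_ineq)
      also have "norm (\<rho> (star v * v) *\<^sub>C e) \<le> r"
        using peak_norm[OF \<rho> e] r0 by (simp add: norm_scaleC real mult_left_le)
      finally have "(norm (v * e))\<^sup>2 \<le> r + \<epsilon>" using n2 by simp
      then have ve: "norm (v * e) \<le> sqrt (r + \<epsilon>)" by (rule real_le_rsqrt)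
      have eD: "e \<in> D" using peak_mem[OF \<rho> e] .
      define w where "w = v * (e * e) * star v"
      have w: "w \<in> D" unfolding w_def using vD(1)[of "e * e"] eD by simp
      have sw: "\<sigma> w = of_real r"
        using v(2) eD peak_val[OF \<rho> e] char_mult[OF \<rho> eD eD] by (simp add: w_def linked_def real)
      have mem: "w * m \<in> M" "w * m * e \<in> M" using bimodule_mult[OF M] m w eD by auto
      have "\<phi> (w * m * e) = of_real r * \<phi> m"
        using \<phi> mem m w eD peak_val[OF \<rho> e] by (simp add: eigenfunctional_def sw)
      then have "r * norm (\<phi> m) = norm (\<phi> (w * m * e))" using r0 by (simp add: norm_mult)
      also have "\<dots> \<le> N * norm (w * m * e)" by (rule N[OF mem(2)])
      also have "w * m * e = v * e * (e * (star v * m) * e - p *\<^sub>C (e * e)) + p *\<^sub>C (v * e * (e * e))"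
        by (simp add: w_def right_diff_distrib mult_scaleC_right mult.assoc)
      also have "norm \<dots> \<le> norm (v * e * (e * (star v * m) * e - p *\<^sub>C (e * e))) + norm (p *\<^sub>C (v * e * (e * e)))"
        by (rule norm_triangle_ineq)
      also have "norm (v * e * (e * (star v * m) * e - p *\<^sub>C (e * e))) \<le> norm v * \<epsilon>"
        using norm_mult_peak_le[OF \<rho> e, of v] n1
        by (intro order_trans[OF norm_mult_ineq[of "v * e"] mult_mono]) auto
      also have "norm (p *\<^sub>C (v * e * (e * e))) \<le> norm p * sqrt (r + \<epsilon>)"
        using norm_mult_peak_le[OF \<rho> peak_mult[OF \<rho> e e], of "v * e"] ve
        by (simp add: norm_scaleC mult_left_mono)
      finally show ?thesis using N0 by (simp add: mult_left_mono)
    qed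
    have "r * norm (\<phi> m) \<le> N * (norm v * 0 + norm p * sqrt (r + 0))"
    proof (rule tendsto_lowerbound)
      show "((\<lambda>\<epsilon>. N * (norm v * \<epsilon> + norm p * sqrt (r + \<epsilon>))) \<longlongrightarrow> N * (norm v * 0 + norm p * sqrt (r + 0))) (at_right 0)"
        by (intro tendsto_intros)
      show "\<forall>\<^sub>F \<epsilon> in at_right 0. r * norm (\<phi> m) \<le> N * (norm v * \<epsilon> + norm p * sqrt (r + \<epsilon>))"
        using eventually_at_right_less[of "0::real"] by eventually_elim (rule key)
    qed simp
    then have "sqrt r * (sqrt r * norm (\<phi> m)) \<le> sqrt r * (N * norm p)"
    proof -
      have "sqrt r * (sqrt r * norm (\<phi> m)) = r * norm (\<phi> m)" using r0 by (simp flip: mult.assoc)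
      moreover have "sqrt r * (N * norm p) = N * (norm v * 0 + norm p * sqrt (r + 0))" by simp
      ultimately show ?thesis
        using \<open>r * norm (\<phi> m) \<le> N * (norm v * 0 + norm p * sqrt (r + 0))\<close> by (simp only:)
    qed
    then have "sqrt r * norm (\<phi> m) \<le> N * norm p" using r0 by (simp add: mult_le_cancel_left)
    then show ?thesis by (simp add: N_def p_def r_def mult.commute)
  qed
qed

text \<open>
  By the upper bound, \<open>\<phi>\<close> vanishes wherever \<open>m \<mapsto> ext \<rho> (star v * m)\<close> does, so the two functionals are
  proportional on \<open>M\<close>; Cauchy-Schwarz for the state \<open>ext \<rho>\<close> bounds the norm of the latter.
\<close>

lemma eigenfunctional_norm_eq:
  assumes M: "bimodule D M" and \<sigma>: "character D \<sigma>" and \<rho>: "character D \<rho>"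
    and \<phi>: "eigenfunctional D M \<sigma> \<rho> \<phi>" and v: "v \<in> normalizers D" "linked v \<sigma> \<rho>"
    and r: "Re (\<rho> (star v * v)) > 0" and m: "m \<in> M" and nz: "\<phi> m \<noteq> 0"
  shows "norm (\<phi> m) * sqrt (Re (\<rho> (star v * v))) = dual_norm M \<phi> * norm (ext \<rho> (star v * m))"
proof (rule antisym[OF eigenfunctional_upper[OF M \<sigma> \<rho> \<phi> v r m]])
  interpret U: unital_subalgebra "UNIV :: 'a set" by (rule unital_subalgebra_UNIV)
  note vD = normalizer_mem[OF v(1)] and cs = bimodule_csubspace[OF M]
  note lin = ext_linear[OF \<rho>] and pf = ext_positive[OF \<rho>]
  define r where "r = Re (\<rho> (star v * v))"
  have cd: "\<phi> \<in> cdual M" using \<phi> by (simp add: eigenfunctional_def)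
  then have linM: "complex_linear_on M \<phi>" by (simp add: cdual_def complex_linear_on_def)
  define p where "p x = ext \<rho> (star v * x)" for x
  have p0: "\<phi> x = 0" if "x \<in> M" "p x = 0" for x
    using eigenfunctional_upper[OF M \<sigma> \<rho> \<phi> v assms(7) that(1)] that(2) assms(7)
    by (simp add: p_def mult_le_0_iff)
  have pm: "p m \<noteq> 0" using p0 m nz by blast
  have proportional: "\<phi> x * p m = \<phi> m * p x" if x: "x \<in> M" for x
  proof -
    define y where "y = p m *\<^sub>C x - p x *\<^sub>C m"
    have y: "y \<in> M" unfolding y_def
      using x m cs by (intro complex_vector.subspace_diff complex_vector.subspace_scale)
    have "p y = 0"
      by (simp add: p_def y_def right_diff_distrib mult_scaleC_right complex_linear_on_diff[OF lin U.csub]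
        complex_linear_on_scaleC[OF lin])
    then have "\<phi> y = 0" using p0 y by blast
    then show ?thesis using x m cs
      by (simp add: y_def complex_linear_on_diff[OF linM cs] complex_linear_on_scaleC[OF linM]
        complex_vector.subspace_scale mult.commute)
  qed
  have CS: "norm (p x) \<le> sqrt r * norm x" for x
  proof -
    have "(norm (p x))\<^sup>2 \<le> Re (ext \<rho> (star v * v)) * Re (ext \<rho> (star x * x))"
      using U.pf_cauchy_schwarz[OF pf, of v x] by (simp add: p_def)
    also have "\<dots> \<le> r * (norm x)\<^sup>2"
      using U.pf_star_mult_self_le[OF pf, of x] ext_eq[OF \<rho> vD(2)] ext_eq[OF \<rho> one] char_one[OF \<rho>] assms(7)
      by (simp add: r_def mult_left_mono)
    finally have "norm (p x) \<le> sqrt (r * (norm x)\<^sup>2)" by (rule real_le_rsqrt)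
    then show ?thesis by (simp add: real_sqrt_mult)
  qed
  have "dual_norm M \<phi> \<le> norm (\<phi> m) * sqrt r / norm (p m)"
  proof (rule dual_norm_le[OF cs])
    show "0 \<le> norm (\<phi> m) * sqrt r / norm (p m)" using assms(7) by (simp add: r_def)
    fix x assume x: "x \<in> M"
    have "norm (\<phi> x) * norm (p m) = norm (\<phi> m) * norm (p x)" using proportional[OF x] by (metis norm_mult)
    also have "\<dots> \<le> norm (\<phi> m) * (sqrt r * norm x)" by (rule mult_left_mono[OF CS]) simp
    finally show "norm (\<phi> x) \<le> norm (\<phi> m) * sqrt r / norm (p m) * norm x"
      using pm by (simp add: field_simps)
  qed
  then show "dual_norm M \<phi> * norm (ext \<rho> (star v * m)) \<le> norm (\<phi> m) * sqrt (Re (\<rho> (star v * v)))"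
    using pm by (simp add: r_def p_def field_simps)
qed

text \<open>
  Each value of \<open>Re (ext \<rho> y)\<close> is an infimum of functions continuous in \<open>\<rho>\<close>, hence upper
  semicontinuous; applying this also to \<open>- y\<close> gives continuity.
\<close>

lemma ext_tendsto:
  assumes \<rho>: "character D \<rho>" and chars: "\<forall>\<^sub>F i in F. character D (\<rho>' i)"
    and lim: "\<And>d. d \<in> D \<Longrightarrow> ((\<lambda>i. \<rho>' i d) \<longlongrightarrow> \<rho> d) F"
  shows "((\<lambda>i. ext (\<rho>' i) x) \<longlongrightarrow> ext \<rho> x) F"
proof -
  have cs: "csubspace (UNIV :: 'a set)" by (rule complex_vector.subspace_UNIV)
  have neg: "ext \<rho> (- y) = - ext \<rho> y" if "character D \<rho>" for \<rho> y
    using complex_linear_on_scaleC[OF ext_linear[OF that], of y "-1"]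
    by (simp add: complex_vector.scale_minus_left)
  have up: "\<forall>\<^sub>F i in F. Re (ext (\<rho>' i) y) < a" if a: "Re (ext \<rho> y) < a" for y a
  proof -
    obtain d where d: "d \<in> majorants y" "Re (\<rho> d) < a"
      using ext_majorant[OF \<rho>, of "a - Re (ext \<rho> y)" y] a by auto
    have "((\<lambda>i. Re (\<rho>' i d)) \<longlongrightarrow> Re (\<rho> d)) F"
      using d(1) by (intro tendsto_Re lim) (simp add: majorants_def)
    then have "\<forall>\<^sub>F i in F. Re (\<rho>' i d) < a" using d(2) by (rule order_tendstoD)
    then show ?thesis using chars
    proof eventually_elim
      case (elim i)
      then show ?case using upper_le[OF elim(2) d(1)] Re_ext[OF elim(2), of y] by simp
    qed
  qed
  have Re: "((\<lambda>i. Re (ext (\<rho>' i) y)) \<longlongrightarrow> Re (ext \<rho> y)) F" for y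
  proof (rule order_tendstoI)
    fix a assume "a < Re (ext \<rho> y)"
    then have "\<forall>\<^sub>F i in F. Re (ext (\<rho>' i) (- y)) < - a" by (intro up) (simp add: neg[OF \<rho>])
    then show "\<forall>\<^sub>F i in F. a < Re (ext (\<rho>' i) y)"
      using chars by eventually_elim (simp add: neg)
  qed (rule up)
  have Im: "Im (ext \<rho> y) = Re (ext \<rho> (- \<i> *\<^sub>C y))" if "character D \<rho>" for \<rho> y
    using complex_linear_on_scaleC[OF ext_linear[OF that], of y "- \<i>"] by simp
  have "\<forall>\<^sub>F i in F. Re (ext (\<rho>' i) (- \<i> *\<^sub>C x)) = Im (ext (\<rho>' i) x)"
    using chars by eventually_elim (simp add: Im)
  then have "((\<lambda>i. Im (ext (\<rho>' i) x)) \<longlongrightarrow> Im (ext \<rho> x)) F"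
    using Re[of "- \<i> *\<^sub>C x"] Im[OF \<rho>, of x] by (simp add: tendsto_cong)
  then show ?thesis using Re[of x] by (simp add: tendsto_complex_iff)
qed

end

section \<open>Pointwise limits of norm-one eigenfunctionals\<close>

context extension_inclusion
begin

text \<open>
  The bound \<open>c / (2 * (card I + 1))\<close> is independent of \<open>\<phi>\<close>, which is what allows a passage to the
  limit. If it failed for every \<open>a\<close>, then \<open>\<phi> m = \<phi> (e * m * f)\<close> would have modulus less than \<open>c\<close>.
\<close>

lemma eigenfunctional_normalizer:
  assumes M: "bimodule D M" and \<sigma>: "character D \<sigma>" and \<rho>: "character D \<rho>"
    and \<phi>: "eigenfunctional D M \<sigma> \<rho> \<phi>" and N: "dual_norm M \<phi> \<le> 1"
    and m: "m \<in> M" and I: "finite I" and near: "norm (m - (\<Sum>a\<in>I. g a)) < c / 2" and c: "c < norm (\<phi> m)" "c > 0"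
  shows "\<exists>a\<in>I. \<forall>e\<in>peak D \<sigma>. \<forall>f\<in>peak D \<rho>. c / (2 * (real (card I) + 1)) \<le> norm (e * g a * f)"
proof (rule ccontr)
  define k where "k = c / (2 * (real (card I) + 1))"
  have cd: "\<phi> \<in> cdual M" using \<phi> by (simp add: eigenfunctional_def)
  assume "\<not> (\<exists>a\<in>I. \<forall>e\<in>peak D \<sigma>. \<forall>f\<in>peak D \<rho>. c / (2 * (real (card I) + 1)) \<le> norm (e * g a * f))"
  then have "\<And>a. a \<in> I \<Longrightarrow> \<exists>e\<in>peak D \<sigma>. \<exists>f\<in>peak D \<rho>. norm (e * g a * f) < k"
    unfolding k_def by (meson not_le)
  from ex_peaks_sum[OF \<sigma> \<rho> I, of g k, OF this] obtain e f where e: "e \<in> peak D \<sigma>" and f: "f \<in> peak D \<rho>"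
    and ef: "norm (e * (\<Sum>a\<in>I. g a) * f) \<le> card I * k" by blast
  note eD = peak_mem[OF \<sigma> e] and fD = peak_mem[OF \<rho> f]
  have mem: "e * m \<in> M" "e * m * f \<in> M" using bimodule_mult[OF M] m eD fD by auto
  have "\<phi> (e * m * f) = \<phi> m"
    using \<phi> m mem eD fD peak_val[OF \<sigma> e] peak_val[OF \<rho> f] by (simp add: eigenfunctional_def)
  then have "norm (\<phi> m) \<le> dual_norm M \<phi> * norm (e * m * f)"
    using dual_norm_bound[OF bimodule_csubspace[OF M] cd mem(2)] by simp
  also have "\<dots> \<le> 1 * norm (e * m * f)" by (rule mult_right_mono[OF N]) simp
  also have "e * m * f = e * (m - (\<Sum>a\<in>I. g a)) * f + e * (\<Sum>a\<in>I. g a) * f" by (simp add: algebra_simps)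
  also have "norm \<dots> \<le> norm (e * (m - (\<Sum>a\<in>I. g a)) * f) + norm (e * (\<Sum>a\<in>I. g a) * f)"
    by (rule norm_triangle_ineq)
  also have "norm (e * (m - (\<Sum>a\<in>I. g a)) * f) \<le> norm (m - (\<Sum>a\<in>I. g a))"
    by (rule order_trans[OF norm_mult_peak_le[OF \<rho> f] norm_peak_mult_le[OF \<sigma> e]])
  finally have "norm (\<phi> m) < c / 2 + card I * k" using near ef by simp
  also have "card I * k \<le> (real (card I) + 1) * k" using c by (intro mult_right_mono) (auto simp: k_def)
  also have "\<dots> = c / 2"
  proof -
    have eq: "n * (c / (2 * n)) = c / 2" if "n > 0" for n :: real using that by simp
    show ?thesis unfolding k_def by (rule eq) (simp add: add_nonneg_pos)
  qed
  finally show False using c by simp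
qed

text \<open>
  The heart of the matter: the norm does not drop in the limit unless the limit is 0. A finite sum of
  normalizers near \<open>m0\<close> is fixed first; one of its terms \<open>v\<close> is then linked to frequently many \<open>\<psi>\<close>,
  and the norm formula for these \<open>\<psi>\<close> passes to the limit along the refined filter \<open>G\<close>.
\<close>

lemma norm_one_eigenfunctionals_limit:
  assumes dense: "closure (cspan (normalizers D)) = UNIV" and M: "bimodule D M"
    and F: "F \<noteq> bot" and mem: "\<forall>\<^sub>F \<psi> in F. \<psi> \<in> \<E>\<^sup>1 D M \<union> {\<lambda>m\<in>M. 0}"
    and lim: "\<And>m. m \<in> M \<Longrightarrow> ((\<lambda>\<psi>. \<psi> m) \<longlongrightarrow> \<phi> m) F" and ext: "\<phi> \<in> extensional M"
  shows "\<phi> \<in> \<E>\<^sup>1 D M \<union> {\<lambda>m\<in>M. 0}"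
proof (cases "\<exists>m0\<in>M. \<phi> m0 \<noteq> 0")
  case False
  then have "\<phi> = (\<lambda>m\<in>M. 0)" using ext by (auto simp: extensional_def fun_eq_iff)
  then show ?thesis by simp
next
  case True
  then obtain m0 where m0: "m0 \<in> M" "\<phi> m0 \<noteq> 0" by blast
  note cs = bimodule_csubspace[OF M]
  define c where "c = norm (\<phi> m0) / 2"
  have c: "c > 0" "c < norm (\<phi> m0)" using m0 by (auto simp: c_def)
  have big: "\<forall>\<^sub>F \<psi> in F. c < norm (\<psi> m0)"
    using tendsto_norm[OF lim[OF m0(1)]] c(2) by (rule order_tendstoD)
  let ?P = "\<lambda>\<psi>. \<psi> \<in> cdual M \<and> dual_norm M \<psi> = 1 \<and> c < norm (\<psi> m0) \<and>
     eigenfunctional D M (range_char m0 \<psi>) (source_char m0 \<psi>) \<psi> \<and>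
     character D (range_char m0 \<psi>) \<and> character D (source_char m0 \<psi>)"
  have P: "\<forall>\<^sub>F \<psi> in F. ?P \<psi>"
    using mem big
  proof eventually_elim
    case (elim \<psi>)
    then have nz: "\<psi> m0 \<noteq> 0" using c by auto
    then have E: "\<psi> \<in> \<E>\<^sup>1 D M" using elim m0 by auto
    then have cd: "\<psi> \<in> cdual M" by (simp add: norm_one_eigenfunctionals_def)
    show ?case
      using eigenfunctional_characters[OF M cd m0(1) nz] E elim(2)
      by (auto simp: norm_one_eigenfunctionals_def)
  qed
  have cd: "\<phi> \<in> cdual M" and N1: "dual_norm M \<phi> \<le> 1"
  proof -
    have "\<phi> (x + y) = \<phi> x + \<phi> y" if "x \<in> M" "y \<in> M" for x y
    proof (rule tendsto_unique[OF F lim])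
      have "\<forall>\<^sub>F \<psi> in F. \<psi> x + \<psi> y = \<psi> (x + y)"
        using P by eventually_elim (use that in \<open>simp add: cdual_def\<close>)
      then show "((\<lambda>\<psi>. \<psi> (x + y)) \<longlongrightarrow> \<phi> x + \<phi> y) F"
        by (rule Lim_transform_eventually[rotated]) (intro tendsto_add lim that)
    qed (use that cs in \<open>simp add: complex_vector.subspace_add\<close>)
    moreover have "\<phi> (a *\<^sub>C x) = a * \<phi> x" if "x \<in> M" for a x
    proof (rule tendsto_unique[OF F lim])
      have "\<forall>\<^sub>F \<psi> in F. a * \<psi> x = \<psi> (a *\<^sub>C x)"
        using P by eventually_elim (use that in \<open>simp add: cdual_def\<close>)
      then show "((\<lambda>\<psi>. \<psi> (a *\<^sub>C x)) \<longlongrightarrow> a * \<phi> x) F"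
        by (rule Lim_transform_eventually[rotated]) (intro tendsto_mult tendsto_const lim that)
    qed (use that cs in \<open>simp add: complex_vector.subspace_scale\<close>)
    moreover have bd: "norm (\<phi> x) \<le> 1 * norm x" if "x \<in> M" for x
    proof (rule tendsto_upperbound[OF tendsto_norm[OF lim[OF that]] _ F])
      show "\<forall>\<^sub>F \<psi> in F. norm (\<psi> x) \<le> 1 * norm x"
        using P by eventually_elim (use dual_norm_bound[OF cs _ that] in fastforce)
    qed
    ultimately show "\<phi> \<in> cdual M" using ext unfolding cdual_def by blast
    show "dual_norm M \<phi> \<le> 1" by (rule dual_norm_le[OF cs _ bd]) simp_all
  qed
  define \<sigma> where "\<sigma> = range_char m0 \<phi>"
  define \<rho> where "\<rho> = source_char m0 \<phi>"
  have limr: "((\<lambda>\<psi>. range_char m0 \<psi> d) \<longlongrightarrow> \<sigma> d) F" if "d \<in> D" for d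
    unfolding \<sigma>_def range_char_def using that m0 by (intro tendsto_divide lim bimodule_mult[OF M])
  have lims: "((\<lambda>\<psi>. source_char m0 \<psi> d) \<longlongrightarrow> \<rho> d) F" if "d \<in> D" for d
    unfolding \<rho>_def source_char_def using that m0 by (intro tendsto_divide lim bimodule_mult[OF M])
  have L: "\<phi> (d * m) = \<sigma> d * \<phi> m" if "d \<in> D" "m \<in> M" for d m
  proof (rule tendsto_unique[OF F lim])
    have "\<forall>\<^sub>F \<psi> in F. range_char m0 \<psi> d * \<psi> m = \<psi> (d * m)"
      using P by eventually_elim (use that in \<open>simp add: eigenfunctional_def\<close>)
    then show "((\<lambda>\<psi>. \<psi> (d * m)) \<longlongrightarrow> \<sigma> d * \<phi> m) F"
      by (rule Lim_transform_eventually[rotated]) (intro tendsto_mult limr lim that)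
  qed (use that bimodule_mult[OF M] in simp)
  have R: "\<phi> (m * d) = \<rho> d * \<phi> m" if "d \<in> D" "m \<in> M" for d m
  proof (rule tendsto_unique[OF F lim])
    have "\<forall>\<^sub>F \<psi> in F. source_char m0 \<psi> d * \<psi> m = \<psi> (m * d)"
      using P by eventually_elim (use that in \<open>simp add: eigenfunctional_def\<close>)
    then show "((\<lambda>\<psi>. \<psi> (m * d)) \<longlongrightarrow> \<rho> d * \<phi> m) F"
      by (rule Lim_transform_eventually[rotated]) (intro tendsto_mult lims lim that)
  qed (use that bimodule_mult[OF M] in simp)
  have eig: "eigenfunctional D M \<sigma> \<rho> \<phi>" and \<sigma>: "character D \<sigma>" and \<rho>: "character D \<rho>"
    unfolding \<sigma>_def \<rho>_def
    by (rule eigenfunctional_characters[OF M cd m0]; use L R in blast)+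
  obtain x where x: "x \<in> cspan (normalizers D)" "norm (m0 - x) < c / 2"
    using dense closure_approachable[of m0 "cspan (normalizers D)"] c(1)
    by (metis UNIV_I half_gt_zero dist_commute dist_norm)
  obtain I s where I: "finite I" "I \<subseteq> normalizers D" and xs: "x = (\<Sum>a\<in>I. s a *\<^sub>C a)"
    using x(1) unfolding complex_vector.span_explicit by blast
  define g where "g a = s a *\<^sub>C a" for a
  have gN: "g a \<in> normalizers D" if "a \<in> I" for a
    using I that normalizer_scaleC by (auto simp: g_def)
  define k where "k = c / (2 * (real (card I) + 1))"
  have k: "k > 0" using c by (simp add: k_def add_nonneg_pos)
  let ?Q = "\<lambda>a \<psi>. \<forall>e\<in>peak D (range_char m0 \<psi>). \<forall>f\<in>peak D (source_char m0 \<psi>). k \<le> norm (e * g a * f)"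
  \<comment> \<open>Each \<open>\<psi>\<close> selects some term of the sum. As \<open>I\<close> is finite, one term is selected frequently.\<close>
  have "\<forall>\<^sub>F \<psi> in F. \<exists>a\<in>I. ?Q a \<psi>"
    using P
  proof eventually_elim
    case (elim \<psi>)
    show ?case unfolding k_def
      by (rule eigenfunctional_normalizer[OF M, where \<phi>=\<psi> and \<sigma>="range_char m0 \<psi>" and m=m0])
         (use elim x(2) xs c m0(1) I(1) in \<open>auto simp: g_def\<close>)
  qed
  then have "\<exists>a\<in>I. \<not> (\<forall>\<^sub>F \<psi> in F. \<not> ?Q a \<psi>)"
  proof (rule contrapos_pp)
    assume "\<not> (\<exists>a\<in>I. \<not> (\<forall>\<^sub>F \<psi> in F. \<not> ?Q a \<psi>))"
    then have *: "\<forall>\<^sub>F \<psi> in F. \<forall>a\<in>I. \<not> ?Q a \<psi>"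
      by (intro eventually_ball_finite I(1)) blast
    show "\<not> (\<forall>\<^sub>F \<psi> in F. \<exists>a\<in>I. ?Q a \<psi>)"
    proof
      assume "\<forall>\<^sub>F \<psi> in F. \<exists>a\<in>I. ?Q a \<psi>"
      with * have "\<forall>\<^sub>F \<psi> in F. False" by eventually_elim blast
      then show False using F by (simp add: trivial_limit_def)
    qed
  qed
  then obtain a where a: "a \<in> I" "\<not> (\<forall>\<^sub>F \<psi> in F. \<not> ?Q a \<psi>)" by blast
  define v where "v = g a"
  have v: "v \<in> normalizers D" using gN a by (simp add: v_def)
  note vD = normalizer_mem[OF v]
  define G where "G = inf F (principal {\<psi>. ?Q a \<psi>})"
  have G: "G \<noteq> bot" using a(2) by (simp add: G_def trivial_limit_def eventually_inf_principal)
  have GF: "G \<le> F" by (simp add: G_def)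
  have Q: "\<forall>\<^sub>F \<psi> in G. ?P \<psi> \<and> k\<^sup>2 \<le> Re (source_char m0 \<psi> (star v * v)) \<and>
     linked v (range_char m0 \<psi>) (source_char m0 \<psi>)"
    using filter_leD[OF GF P] unfolding G_def eventually_inf_principal
  proof eventually_elim
    case (elim \<psi>)
    then show ?case
      using normalizer_linked[OF v, of "range_char m0 \<psi>" "source_char m0 \<psi>" k] k
      by (auto simp: v_def)
  qed
  note limG = tendsto_mono[OF GF lim] and limrG = tendsto_mono[OF GF limr] and limsG = tendsto_mono[OF GF lims]
  define r where "r = Re (\<rho> (star v * v))"
  have limRe: "((\<lambda>\<psi>. Re (source_char m0 \<psi> (star v * v))) \<longlongrightarrow> r) G"
    unfolding r_def by (intro tendsto_Re limsG vD)
  have "k\<^sup>2 \<le> r"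
    by (rule tendsto_lowerbound[OF limRe _ G]) (use Q in \<open>auto elim: eventually_mono\<close>)
  then have r: "r > 0" using k by (smt (verit) zero_less_power)
  have linked: "linked v \<sigma> \<rho>"
    unfolding linked_def
  proof
    fix d assume d: "d \<in> D"
    show "\<sigma> (v * d * star v) = \<rho> d * \<rho> (star v * v)"
    proof (rule tendsto_unique[OF G limrG[OF vD(1)[OF d]]])
      have "\<forall>\<^sub>F \<psi> in G. source_char m0 \<psi> d * source_char m0 \<psi> (star v * v) = range_char m0 \<psi> (v * d * star v)"
        using Q by eventually_elim (use d in \<open>simp add: linked_def\<close>)
      then show "((\<lambda>\<psi>. range_char m0 \<psi> (v * d * star v)) \<longlongrightarrow> \<rho> d * \<rho> (star v * v)) G"
        by (rule Lim_transform_eventually[rotated]) (intro tendsto_mult limsG d vD)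
    qed
  qed
  have extlim: "((\<lambda>\<psi>. ext (source_char m0 \<psi>) (star v * m0)) \<longlongrightarrow> ext \<rho> (star v * m0)) G"
    by (rule ext_tendsto[OF \<rho> _ limsG]) (use Q in \<open>auto elim: eventually_mono\<close>)
  have "norm (\<phi> m0) * sqrt r = norm (ext \<rho> (star v * m0))"
  proof (rule tendsto_unique[OF G])
    show "((\<lambda>\<psi>. norm (\<psi> m0) * sqrt (Re (source_char m0 \<psi> (star v * v)))) \<longlongrightarrow> norm (\<phi> m0) * sqrt r) G"
      by (intro tendsto_mult tendsto_norm limG m0 tendsto_real_sqrt limRe)
    have "\<forall>\<^sub>F \<psi> in G. norm (ext (source_char m0 \<psi>) (star v * m0))
        = norm (\<psi> m0) * sqrt (Re (source_char m0 \<psi> (star v * v)))"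
      using Q
    proof eventually_elim
      case (elim \<psi>)
      have "0 < Re (source_char m0 \<psi> (star v * v))" using elim k by (smt (verit) zero_less_power)
      moreover have "\<psi> m0 \<noteq> 0" using elim c by auto
      ultimately show ?case
        using eigenfunctional_norm_eq[OF M, of "range_char m0 \<psi>" "source_char m0 \<psi>" \<psi> v m0] elim v m0 by simp
    qed
    then show "((\<lambda>\<psi>. norm (\<psi> m0) * sqrt (Re (source_char m0 \<psi> (star v * v)))) \<longlongrightarrow> norm (ext \<rho> (star v * m0))) G"
      by (rule Lim_transform_eventually[rotated]) (intro tendsto_norm extlim)
  qed
  then have "norm (\<phi> m0) * sqrt r \<le> dual_norm M \<phi> * (norm (\<phi> m0) * sqrt r)"
    using eigenfunctional_upper[OF M \<sigma> \<rho> eig v linked _ m0(1)] r by (simp add: r_def)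
  then have "1 \<le> dual_norm M \<phi>" using m0 r by simp
  then have "dual_norm M \<phi> = 1" using N1 by simp
  then show ?thesis using cd L R by (auto simp: norm_one_eigenfunctionals_def)
qed

end

section \<open>Compactness\<close>

text \<open>
  A point of the closure is a pointwise limit along a proper filter concentrated on the set, which
  lets the previous lemma work with ordinary limits.
\<close>

lemma product_topology_closure_filter:
  fixes S :: "('a \<Rightarrow> complex) set"
  assumes "\<phi> \<in> product_topology (\<lambda>_. euclidean) M closure_of S"
  obtains F where "F \<noteq> bot" "\<forall>\<^sub>F \<psi> in F. \<psi> \<in> S" "\<And>m. m \<in> M \<Longrightarrow> ((\<lambda>\<psi>. \<psi> m) \<longlongrightarrow> \<phi> m) F"
proof -
  let ?X = "product_topology (\<lambda>_. euclidean :: complex topology) M"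
  define F where "F = inf (nhdsin ?X \<phi>) (principal S)"
  have top: "\<phi> \<in> topspace ?X" and meets: "\<And>T. \<phi> \<in> T \<Longrightarrow> openin ?X T \<Longrightarrow> \<exists>y. y \<in> S \<and> y \<in> T"
    using assms by (auto simp only: in_closure_of)
  show thesis
  proof (rule that[of F])
    show "F \<noteq> bot"
      using top meets unfolding trivial_limit_def F_def eventually_inf_principal eventually_nhdsin by blast
    show "\<forall>\<^sub>F \<psi> in F. \<psi> \<in> S" by (simp add: F_def eventually_inf_principal)
    fix m assume m: "m \<in> M"
    show "((\<lambda>\<psi>. \<psi> m) \<longlongrightarrow> \<phi> m) F"
    proof (rule topological_tendstoI)
      fix U :: "complex set" assume U: "open U" "\<phi> m \<in> U"
      have "openin ?X {\<psi> \<in> topspace ?X. \<psi> m \<in> U}"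
        using openin_continuous_map_preimage[OF continuous_map_product_projection[OF m, of "\<lambda>_. euclidean"], of U] U by simp
      then have "\<forall>\<^sub>F \<psi> in nhdsin ?X \<phi>. \<psi> m \<in> U"
        unfolding eventually_nhdsin using top U by blast
      then show "\<forall>\<^sub>F \<psi> in F. \<psi> m \<in> U" by (simp add: F_def eventually_inf_principal eventually_mono)
    qed
  qed
qed

theorem proposition4p18:
  fixes D M :: "'a::cstar_algebra_1 set"
  assumes "regular_cstar_inclusion D"
    and "bimodule D M"
    and "closed M"
  shows "compactin (weak_star M) (\<E>\<^sup>1 D M \<union> {\<lambda>m\<in>M. 0}) \<and>
    locally_compact_space (subtopology (weak_star M) (\<E>\<^sup>1 D M)) \<and>
    Hausdorff_space (subtopology (weak_star M) (\<E>\<^sup>1 D M))"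
proof -
  interpret extension_inclusion D
    using assms(1) by unfold_locales
      (auto simp: regular_cstar_inclusion_def maximal_abelian_cstar_subalgebra_def abelian_cstar_subalgebra_def)
  note cs = bimodule_csubspace[OF assms(2)]
  let ?X = "product_topology (\<lambda>_. euclidean :: complex topology) M"
  let ?S = "\<E>\<^sup>1 D M \<union> {\<lambda>m\<in>M. 0}"
  let ?B = "\<Pi>\<^sub>E m\<in>M. cball 0 (norm m) :: complex set"
  have zero: "(\<lambda>m\<in>M. 0) \<in> cdual M"
    unfolding cdual_def using cs
    by (auto simp: complex_vector.subspace_add complex_vector.subspace_scale intro!: exI[of _ 0])
  have SB: "?S \<subseteq> ?B"
  proof
    fix \<psi> assume "\<psi> \<in> ?S"
    then show "\<psi> \<in> ?B"
    proof
      assume "\<psi> \<in> \<E>\<^sup>1 D M"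
      then have \<psi>: "\<psi> \<in> cdual M" "dual_norm M \<psi> = 1" by (auto simp: norm_one_eigenfunctionals_def)
      then show ?thesis
        using dual_norm_bound[OF cs \<psi>(1)] by (auto simp: PiE_def cdual_def)
    qed auto
  qed
  have SX: "?S \<subseteq> topspace ?X" using SB by (auto simp: PiE_def)
  have "?X closure_of ?S \<subseteq> ?S"
  proof
    fix \<phi> assume \<phi>: "\<phi> \<in> ?X closure_of ?S"
    then obtain F where F: "F \<noteq> bot" "\<forall>\<^sub>F \<psi> in F. \<psi> \<in> ?S" "\<And>m. m \<in> M \<Longrightarrow> ((\<lambda>\<psi>. \<psi> m) \<longlongrightarrow> \<phi> m) F"
      using product_topology_closure_filter by metis
    have "\<phi> \<in> extensional M" using \<phi> by (auto simp: in_closure_of PiE_def)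
    then show "\<phi> \<in> ?S"
      using norm_one_eigenfunctionals_limit[OF _ assms(2) F] assms(1) by (simp add: regular_cstar_inclusion_def)
  qed
  then have "closedin ?X ?S" using SX closure_of_subset_eq by blast
  moreover have "compactin ?X ?B" by (simp add: compactin_PiE)
  ultimately have "compactin ?X ?S" using SB closed_compactin by blast
  moreover have "?S \<subseteq> cdual M" using zero by (auto simp: norm_one_eigenfunctionals_def)
  ultimately have comp: "compactin (weak_star M) ?S" by (simp add: weak_star_def compactin_subtopology)
  have haus: "Hausdorff_space (weak_star M)"
    unfolding weak_star_def by (intro Hausdorff_space_subtopology) (simp add: Hausdorff_space_product_topology)
  let ?T = "subtopology (weak_star M) ?S"
  have hT: "Hausdorff_space ?T" by (rule Hausdorff_space_subtopology[OF haus])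
  have topT: "topspace ?T = ?S" using compactin_subset_topspace[OF comp] by (simp add: inf_absorb2)
  have lT: "locally_compact_space ?T"
    by (intro compact_imp_locally_compact_space compact_space_subtopology comp)
  have "dual_norm M (\<lambda>m\<in>M. 0) \<le> 0" by (rule dual_norm_le[OF cs]) auto
  then have n0: "(\<lambda>m\<in>M. 0) \<notin> \<E>\<^sup>1 D M" by (auto simp: norm_one_eigenfunctionals_def)
  have "closedin ?T {\<lambda>m\<in>M. 0}" by (rule closedin_Hausdorff_singleton[OF hT], subst topT) simp
  then have "openin ?T (topspace ?T - {\<lambda>m\<in>M. 0})" by blast
  moreover have "topspace ?T - {\<lambda>m\<in>M. 0} = \<E>\<^sup>1 D M" using topT n0 by auto
  ultimately have "openin ?T (\<E>\<^sup>1 D M)" by simp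
  then have "locally_compact_space (subtopology ?T (\<E>\<^sup>1 D M))"
    using locally_compact_space_open_subset[of ?T] hT lT by blast
  moreover have "subtopology ?T (\<E>\<^sup>1 D M) = subtopology (weak_star M) (\<E>\<^sup>1 D M)"
    unfolding subtopology_subtopology by (rule arg_cong[where f="subtopology (weak_star M)"]) blast
  ultimately show ?thesis using comp Hausdorff_space_subtopology[OF haus] by simp
qed

end
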